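(* Let $K$ be a commutative ring and $n\ge4$. Each automorphism $\sigma\in\Gamma$ is a unique product $$\sigma=\phi'_{a(2)}\phi'_{a(4)}\cdots\phi'_{a(2[\frac{n-1}2])}\gamma$$ for unique elements $a(2s)\in\Lambda_{n,2s}$, $s=1,\dots,\left[\frac{n-1}2\right]$, and $\gamma\in\Gamma_{2[\frac{n-1}2]+2}=\Sigma$. Moreover, $$\mathcal J(\sigma)\equiv 1+a(2)\mod E'_{n,4},$$ $$\mathcal J\big(\phi'^{-1}_{a(2t-2)}\cdots\phi'^{-1}_{a(2)}\sigma\big)\equiv 1+a(2t)\mod E'_{n,2t+2},\qquad t=2,\dots,\left[\tfrac{n-1}2\right],$$ $$\gamma=\big(\phi'_{a(2)}\phi'_{a(4)}\cdots\phi'_{a(2[\frac{n-1}2])}\big)^{-1}\sigma.$$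
   Context: $\Lambda_n=\Lambda_n(K)$ is the Grassmann $K$-algebra generated freely over $K$ by $x_1,\dots,x_n$ subject to $x_i^2=0$, $x_ix_j=-x_jx_i$ ($i\ne j$); it is free over $K$ with basis $x^\alpha=x_{i_1}\cdots x_{i_k}$, $\alpha=\{i_1<\dots<i_k\}\subseteq\{1,\dots,n\}$, graded by $|\alpha|$, with components $\Lambda_{n,d}$; $\mathfrak m=\bigoplus_{d\ge1}\Lambda_{n,d}$; $\Lambda_n^{od}$ is the sum of the odd degree components. $\Gamma$ is the group of $K$-algebra automorphisms $\sigma$ of $\Lambda_n$ with $\sigma(x_i)-x_i\in\Lambda_n^{od}\cap\mathfrak m^3$ for all $i$. The left skew derivation $\partial/\partial x_j$ is the $K$-linear map with $\frac{\partial x_k}{\partial x_j}=\delta_{jk}$ and $\frac{\partial (ab)}{\partial x_j}=\frac{\partial a}{\partial x_j}b+(-1)^i a\frac{\partial b}{\partial x_j}$ for $a\in\Lambda_{n,i}$. For $\sigma\in\Gamma$, $\mathcal J(\sigma)=\det(\partial\sigma(x_i)/\partial x_j)$. $E_n'=1+\sum_{m\ge1}\Lambda_{n,2m}$ is a multiplicative abelian group, $E'_{n,2m}=E_n'\cap(1+\mathfrak m^{2m})$, and $u\equiv v\mod E'_{n,2m}$ for $u,v\in E_n'$ means $uE'_{n,2m}=vE'_{n,2m}$. $\Gamma_{2m}=\{\sigma\in\Gamma\mid\mathcal J(\sigma)\in E'_{n,2m}\}$ and $\Sigma=\{\sigma\in\Gamma\mid\mathcal J(\sigma)=1\}$ is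 the Jacobian group. $[\cdot]$ is the integer part. For $1\le s\le[\frac{n-1}2]$, each $a\in\Lambda_{n,2s}$ is a unique sum $a=a_{n-2s}+a_{n-2s+1}+\dots+a_n$ where $a_i$ is a $K$-linear combination of monomials $x^\alpha$ with $|\alpha|=2s$, $i\notin\alpha$ and $\{i+1,\dots,n\}\subseteq\alpha$. The automorphism $\phi'_a\in\Gamma$ is defined by $\phi'_a(x_k)=x_k$ for $1\le k\le n-2s-1$ and $\phi'_a(x_i)=x_i(1+a_i)$ for $n-2s\le i\le n$. *)

theory Defs
  imports Complex_Main "HOL-Library.FuncSet" "HOL-Library.Cardinality" "HOL-Combinatorics.Permutations"
begin

text \<open>
  The Grassmann algebra over \<open>K\<close> on generators indexed by a finite linearly ordered type; \<open>n\<close> is the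
  number of its elements.  An element is its family of coordinates with respect to the basis of
  monomials \<open>x\<^sup>A\<close>, one for every set \<open>A\<close> of indices.  That this is the algebra presented by
  \<open>x\<^sub>i\<^sup>2 = 0\<close> and \<open>x\<^sub>i x\<^sub>j = - x\<^sub>j x\<^sub>i\<close>, with that basis, is the content of \<open>gvar_square\<close>,
  \<open>gvar_anticommute\<close>, \<open>coeff_gmonom\<close> and \<open>gmonom_expansion\<close> below.
\<close>

typedef ('k, 'n) grassmann = "UNIV :: ('n set \<Rightarrow> 'k) set"
  morphisms coeff Grassmann by simp

setup_lifting type_definition_grassmann

lemma coeff_Grassmann [simp]: "coeff (Grassmann f) = f"
  by (simp add: Grassmann_inverse)

lemma grassmann_eqI: "(\<And>A. coeff f A = coeff g A) \<Longrightarrow> f = g"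
  by (metis coeff_inject ext)

text \<open>The sign by which \<open>x\<^sup>A x\<^sup>B\<close> differs from \<open>x\<^bsup>A \<union> B\<^esup>\<close>, for disjoint \<open>A\<close> and \<open>B\<close>.\<close>

definition gsign :: "'n::{finite,linorder} set \<Rightarrow> 'n set \<Rightarrow> 'k::comm_ring_1"
  where "gsign A B = (-1) ^ card {(i, j). i \<in> A \<and> j \<in> B \<and> j < i}"

instantiation grassmann :: (comm_ring_1, type) ab_group_add
begin
lift_definition zero_grassmann :: "('a, 'b) grassmann" is "\<lambda>A. 0" .
lift_definition plus_grassmann :: "('a, 'b) grassmann \<Rightarrow> ('a, 'b) grassmann \<Rightarrow> ('a, 'b) grassmann"
  is "\<lambda>f g A. f A + g A" .
lift_definition minus_grassmann :: "('a, 'b) grassmann \<Rightarrow> ('a, 'b) grassmann \<Rightarrow> ('a, 'b) grassmann"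
  is "\<lambda>f g A. f A - g A" .
lift_definition uminus_grassmann :: "('a, 'b) grassmann \<Rightarrow> ('a, 'b) grassmann"
  is "\<lambda>f A. - f A" .
instance by standard (transfer; simp add: algebra_simps fun_eq_iff)+
end

lemma coeff_0 [simp]: "coeff 0 A = 0" by transfer simp
lemma coeff_add [simp]: "coeff (f + g) A = coeff f A + coeff g A" by transfer simp
lemma coeff_diff [simp]: "coeff (f - g) A = coeff f A - coeff g A" by transfer simp
lemma coeff_uminus [simp]: "coeff (- f) A = - coeff f A" by transfer simp

lemma coeff_sum [simp]: "coeff (\<Sum>i\<in>I. f i) A = (\<Sum>i\<in>I. coeff (f i) A)"
  by (induction I rule: infinite_finite_induct) auto

lemma gsign_empty [simp]: "gsign {} B = 1" "gsign A {} = 1"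
  by (simp_all add: gsign_def)

lemma gsign_Un_left:
  assumes "A \<inter> B = {}" shows "gsign (A \<union> B) C = gsign A C * gsign B C"
proof -
  have "{(i, j). i \<in> A \<union> B \<and> j \<in> C \<and> j < i} =
    {(i, j). i \<in> A \<and> j \<in> C \<and> j < i} \<union> {(i, j). i \<in> B \<and> j \<in> C \<and> j < i}" by auto
  moreover have "card \<dots> = card {(i, j). i \<in> A \<and> j \<in> C \<and> j < i} + card {(i, j). i \<in> B \<and> j \<in> C \<and> j < i}"
    using assms by (intro card_Un_disjoint) auto
  ultimately show ?thesis by (simp add: gsign_def power_add)
qed

lemma gsign_Un_right:
  assumes "B \<inter> C = {}" shows "gsign A (B \<union> C) = gsign A B * gsign A C"
proof -
  have "{(i, j). i \<in> A \<and> j \<in> B \<union> C \<and> j < i} =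
    {(i, j). i \<in> A \<and> j \<in> B \<and> j < i} \<union> {(i, j). i \<in> A \<and> j \<in> C \<and> j < i}" by auto
  moreover have "card \<dots> = card {(i, j). i \<in> A \<and> j \<in> B \<and> j < i} + card {(i, j). i \<in> A \<and> j \<in> C \<and> j < i}"
    using assms by (intro card_Un_disjoint) auto
  ultimately show ?thesis by (simp add: gsign_def power_add)
qed

instantiation grassmann :: (comm_ring_1, "{finite,linorder}") ring_1
begin
lift_definition one_grassmann :: "('a, 'b) grassmann" is "\<lambda>A. if A = {} then 1 else 0" .
lift_definition times_grassmann :: "('a, 'b) grassmann \<Rightarrow> ('a, 'b) grassmann \<Rightarrow> ('a, 'b) grassmann"
  is "\<lambda>f g C. \<Sum>A\<in>Pow C. gsign A (C - A) * f A * g (C - A)" .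
instance
proof
  fix f g h :: "('a, 'b) grassmann"
  have c1: "coeff 1 A = (if A = {} then 1 else (0::'a))" for A :: "'b set" by transfer simp
  have cm: "coeff (u * v) C = (\<Sum>A\<in>Pow C. gsign A (C - A) * coeff u A * coeff v (C - A))"
    for u v :: "('a, 'b) grassmann" and C by transfer simp
  show "f * g * h = f * (g * h)"
  proof (rule grassmann_eqI)
    fix D
    let ?t = "\<lambda>A B. gsign A (D - A) * gsign B (D - A - B) * coeff f A * coeff g B * coeff h (D - A - B)"
    let ?u = "\<lambda>E A. gsign E (D - E) * gsign A (E - A) * coeff f A * coeff g (E - A) * coeff h (D - E)"
    have "coeff (f * g * h) D = (\<Sum>E\<in>Pow D. \<Sum>A\<in>Pow E. ?u E A)"
      by (simp add: cm sum_distrib_left sum_distrib_right mult_ac)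
    also have "\<dots> = (\<Sum>(E, A)\<in>Sigma (Pow D) Pow. ?u E A)" by (simp add: sum.Sigma)
    also have "\<dots> = (\<Sum>(A, B)\<in>Sigma (Pow D) (\<lambda>A. Pow (D - A)). ?t A B)"
    proof (rule sum.reindex_bij_witness[where i = "\<lambda>(A, B). (A \<union> B, A)" and j = "\<lambda>(E, A). (A, E - A)"])
      fix p assume "p \<in> Sigma (Pow D) Pow"
      then obtain E A where p: "p = (E, A)" "E \<subseteq> D" "A \<subseteq> E" by auto
      have d: "D - A - (E - A) = D - E" using p by auto
      have "gsign E (D - E) = gsign A (D - E) * (gsign (E - A) (D - E) :: 'a)"
        using gsign_Un_left[of A "E - A" "D - E"] p by (simp add: Un_absorb1)
      moreover have "gsign A (D - A) = gsign A (E - A) * (gsign A (D - E) :: 'a)"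
      proof -
        have "D - A = (E - A) \<union> (D - E)" using p by auto
        then show ?thesis using gsign_Un_right[of "E - A" "D - E" A] by auto
      qed
      ultimately show "(case case p of (E, A) \<Rightarrow> (A, E - A) of (A, B) \<Rightarrow> ?t A B) = (case p of (E, A) \<Rightarrow> ?u E A)"
        using p(1) by (simp add: d mult_ac)
    qed auto
    also have "\<dots> = (\<Sum>A\<in>Pow D. \<Sum>B\<in>Pow (D - A). ?t A B)" by (simp add: sum.Sigma)
    also have "\<dots> = coeff (f * (g * h)) D"
      by (simp add: cm sum_distrib_left mult_ac)
    finally show "coeff (f * g * h) D = coeff (f * (g * h)) D" .
  qed
  show "1 * f = f"
  proof (rule grassmann_eqI)
    fix C
    have "coeff (1 * f) C = (\<Sum>A\<in>Pow C. if A = {} then coeff f C else 0)"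
      unfolding cm by (rule sum.cong) (auto simp: c1)
    then show "coeff (1 * f) C = coeff f C" by (simp add: sum.delta)
  qed
  show "f * 1 = f"
  proof (rule grassmann_eqI)
    fix C
    have "coeff (f * 1) C = (\<Sum>A\<in>Pow C. if A = C then coeff f C else 0)"
      unfolding cm by (rule sum.cong) (auto simp: c1)
    then show "coeff (f * 1) C = coeff f C" by (simp add: sum.delta)
  qed
  show "(f + g) * h = f * h + g * h"
    by (rule grassmann_eqI) (simp add: cm algebra_simps sum.distrib)
  show "f * (g + h) = f * g + f * h"
    by (rule grassmann_eqI) (simp add: cm algebra_simps sum.distrib)
  show "(0 :: ('a, 'b) grassmann) \<noteq> 1"
    by (metis c1 coeff_0 zero_neq_one)
qed
end

lemma coeff_1: "coeff 1 A = (if A = {} then 1 else 0)" by transfer simp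

lemma coeff_mult:
  "coeff (f * g) C = (\<Sum>A\<in>Pow C. gsign A (C - A) * coeff f A * coeff g (C - A))"
  by transfer simp

definition gscale :: "'k::comm_ring_1 \<Rightarrow> ('k, 'n) grassmann \<Rightarrow> ('k, 'n) grassmann"
  where "gscale c f = Grassmann (\<lambda>A. c * coeff f A)"

lemma coeff_gscale [simp]: "coeff (gscale c f) A = c * coeff f A"
  by (simp add: gscale_def)

lemma module_gscale: "module gscale"
  by standard (auto intro!: grassmann_eqI simp: algebra_simps)

lemma gscale_mult:
  fixes f g :: "('k::comm_ring_1, 'n::{finite,linorder}) grassmann"
  shows "gscale c f * g = gscale c (f * g)" "f * gscale c g = gscale c (f * g)"
  by (auto intro!: grassmann_eqI simp: coeff_mult sum_distrib_left mult_ac)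

definition gvar :: "'n \<Rightarrow> ('k::comm_ring_1, 'n) grassmann"
  where "gvar i = Grassmann (\<lambda>A. if A = {i} then 1 else 0)"

definition gmonom :: "'n::{finite,linorder} set \<Rightarrow> ('k::comm_ring_1, 'n) grassmann"
  where "gmonom A = prod_list (map gvar (sorted_list_of_set A))"

lemma coeff_gvar: "coeff (gvar i) A = (if A = {i} then 1 else 0)"
  by (simp add: gvar_def)

lemma coeff_gvar_mult:
  "coeff (gvar i * f) C = (if i \<in> C then gsign {i} (C - {i}) * coeff f (C - {i}) else 0)"
proof -
  have "coeff (gvar i * f) C =
    (\<Sum>A\<in>Pow C. if A = {i} then gsign {i} (C - {i}) * coeff f (C - {i}) else 0)"
    unfolding coeff_mult by (rule sum.cong) (auto simp: coeff_gvar)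
  then show ?thesis by (simp add: sum.delta)
qed

lemma gsign_singleton: "gsign {i} B = (-1) ^ card {j \<in> B. j < i}"
proof -
  have "{(i', j). i' \<in> {i} \<and> j \<in> B \<and> j < i'} = Pair i ` {j \<in> B. j < i}" by auto
  moreover have "card \<dots> = card {j \<in> B. j < i}"
    by (rule card_image) (auto intro: inj_onI)
  ultimately show ?thesis by (simp add: gsign_def)
qed

lemma gsign_self [simp]: "gsign A B * gsign A B = (1 :: 'k::comm_ring_1)"
  by (simp add: gsign_def)

lemma gsign_swap:
  assumes "j \<notin> B" shows "gsign B {j} * gsign {j} B = ((-1) ^ card B :: 'k::comm_ring_1)"
proof -
  have "{(i, k). i \<in> B \<and> k \<in> {j} \<and> k < i} = (\<lambda>i. (i, j)) ` {i \<in> B. j < i}" by auto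
  moreover have "card \<dots> = card {i \<in> B. j < i}" by (rule card_image) (auto intro: inj_onI)
  ultimately have "gsign B {j} = ((-1) ^ card {i \<in> B. j < i} :: 'k)" by (simp add: gsign_def)
  moreover have "card B = card {i \<in> B. j < i} + card {i \<in> B. i < j}"
  proof -
    have "i < j \<or> j < i" if "i \<in> B" for i using that assms by (metis linorder_neqE)
    then have "B = {i \<in> B. j < i} \<union> {i \<in> B. i < j}" by auto
    moreover have "card ({i \<in> B. j < i} \<union> {i \<in> B. i < j}) = card {i \<in> B. j < i} + card {i \<in> B. i < j}"
      by (rule card_Un_disjoint) auto
    ultimately show ?thesis by simp
  qed
  ultimately show ?thesis by (simp add: gsign_singleton power_add)
qed

lemma gvar_square: "gvar i * gvar i = (0 :: ('k::comm_ring_1, 'n::{finite,linorder}) grassmann)"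
  by (rule grassmann_eqI) (auto simp: coeff_gvar_mult coeff_gvar)

lemma gvar_anticommute:
  fixes i j :: "'n::{finite,linorder}"
  assumes "i \<noteq> j"
  shows "gvar i * gvar j = - (gvar j * gvar i :: ('k::comm_ring_1, 'n) grassmann)"
proof (rule grassmann_eqI)
  fix C
  show "coeff (gvar i * gvar j) C = coeff (- (gvar j * gvar i :: ('k, 'n) grassmann)) C"
  proof (cases "C = {i, j}")
    case True
    have "{k \<in> {j}. k < i} = (if j < i then {j} else {})" "{k \<in> {i}. k < j} = (if i < j then {i} else {})"
      by auto
    moreover have "C - {i} = {j}" "C - {j} = {i}" using True assms by auto
    ultimately show ?thesis using assms True
      by (auto simp: coeff_gvar_mult coeff_gvar gsign_singleton)
  next
    case False
    then have "i \<notin> C \<or> C - {i} \<noteq> {j}" "j \<notin> C \<or> C - {j} \<noteq> {i}" by auto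
    then show ?thesis by (auto simp: coeff_gvar_mult coeff_gvar)
  qed
qed

lemma gmonom_insert_less:
  assumes "\<And>j. j \<in> A \<Longrightarrow> i < j"
  shows "gmonom (insert i A) = gvar i * gmonom A"
proof -
  have "sorted_list_of_set (insert i A) = i # sorted_list_of_set A"
  proof -
    have "sorted (i # sorted_list_of_set A)" "distinct (i # sorted_list_of_set A)"
      using assms by (auto intro: less_imp_le)
    moreover have "set (i # sorted_list_of_set A) = insert i A" by simp
    ultimately show ?thesis
      by (metis finite sorted_list_of_set.idem_if_sorted_distinct)
  qed
  then show ?thesis by (simp add: gmonom_def)
qed

lemma coeff_gmonom:
  "coeff (gmonom A :: ('k::comm_ring_1, 'n::{finite,linorder}) grassmann) B = (if B = A then 1 else 0)"
proof (induction "card A" arbitrary: A B)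
  case 0
  then show ?case by (simp add: gmonom_def coeff_1)
next
  case (Suc m)
  let ?i = "Min A"
  have A: "A \<noteq> {}" using Suc.hyps(2) by auto
  then have iA: "?i \<in> A" by simp
  have "(gmonom A :: ('k, 'n) grassmann) = gvar ?i * gmonom (A - {?i})"
    using gmonom_insert_less[of "A - {?i}" ?i] iA
    by (metis Diff_iff Min_le finite insertI1 insert_Diff order_le_less)
  moreover have "m = card (A - {?i})" using Suc.hyps(2) iA by simp
  moreover have "{j \<in> A - {?i}. j < ?i} = {}" by (auto simp: not_less)
  then have "gsign {?i} (A - {?i}) = (1 :: 'k)" by (simp only: gsign_singleton card.empty power_0)
  moreover have "?i \<in> B \<and> B - {?i} = A - {?i} \<longleftrightarrow> B = A" using iA by blast
  ultimately show ?case using Suc.hyps(1)[of "A - {?i}" "B - {?i}"]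
    by (cases "B = A") (auto simp: coeff_gvar_mult)
qed

lemma gmonom_expansion: "f = (\<Sum>A\<in>UNIV. gscale (coeff f A) (gmonom A))"
  by (rule grassmann_eqI) (simp add: coeff_gmonom if_distrib sum.delta cong: if_cong)

lemma coeff_in_span:
  assumes "f \<in> module.span gscale {gmonom A | A. P A}" and "\<not> P B"
  shows "coeff f B = 0"
proof -
  interpret m: module gscale by (rule module_gscale)
  from assms(1) show ?thesis
    by (induction rule: m.span_induct_alt) (use assms(2) in \<open>auto simp: coeff_gmonom\<close>)
qed

lemma span_gmonom_iff:
  "f \<in> module.span gscale {gmonom A | A. P A} \<longleftrightarrow> (\<forall>A. coeff f A \<noteq> 0 \<longrightarrow> P A)"
proof -
  interpret m: module gscale by (rule module_gscale)
  have "f \<in> m.span {gmonom A | A. P A}" if "\<forall>A. coeff f A \<noteq> 0 \<longrightarrow> P A"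
  proof -
    have "gscale (coeff f A) (gmonom A) \<in> m.span {gmonom A | A. P A}" for A
    proof (cases "coeff f A = 0")
      case False
      then show ?thesis using that by (intro m.span_scale m.span_base) auto
    qed (simp add: m.span_zero)
    then show ?thesis by (subst gmonom_expansion[of f]) (intro m.span_sum, auto)
  qed
  then show ?thesis using coeff_in_span by blast
qed

text \<open>\<open>gpart D\<close> is the direct sum of the homogeneous components of degree in \<open>D\<close>.\<close>

definition gpart :: "nat set \<Rightarrow> ('k::comm_ring_1, 'n) grassmann set"
  where "gpart D = {f. \<forall>A. coeff f A \<noteq> 0 \<longrightarrow> card A \<in> D}"

abbreviation ghomog :: "nat \<Rightarrow> ('k::comm_ring_1, 'n) grassmann set"
  where "ghomog d \<equiv> gpart {d}"

abbreviation godd :: "('k::comm_ring_1, 'n) grassmann set"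
  where "godd \<equiv> gpart {d. odd d}"

abbreviation gmax :: "('k::comm_ring_1, 'n) grassmann set"
  where "gmax \<equiv> gpart {1..}"

primrec gmax_power :: "nat \<Rightarrow> ('k::comm_ring_1, 'n::{finite,linorder}) grassmann set" where
  "gmax_power 0 = UNIV"
| "gmax_power (Suc k) = module.span gscale {a * b | a b. a \<in> gmax_power k \<and> b \<in> gmax}"

lemma coeff_mult_nonzero:
  assumes "coeff (f * g) C \<noteq> 0"
  obtains A where "A \<subseteq> C" "coeff f A \<noteq> 0" "coeff g (C - A) \<noteq> 0"
proof -
  obtain A where A: "A \<in> Pow C" "gsign A (C - A) * coeff f A * coeff g (C - A) \<noteq> 0"
    using assms unfolding coeff_mult by (meson sum.neutral)
  show ?thesis
  proof (rule that)
    show "A \<subseteq> C" using A(1) by (rule PowD)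
    show "coeff f A \<noteq> 0" using A(2) by (metis mult_zero_left mult_zero_right)
    show "coeff g (C - A) \<noteq> 0" using A(2) by (metis mult_zero_right)
  qed
qed

lemma gmax_power_iff: "f \<in> gmax_power k \<longleftrightarrow> (\<forall>A. coeff f A \<noteq> 0 \<longrightarrow> k \<le> card A)"
proof (induction k arbitrary: f)
  case 0
  then show ?case by simp
next
  case (Suc k)
  interpret m: module gscale by (rule module_gscale)
  let ?S = "{a * b | a b. a \<in> gmax_power k \<and> b \<in> gmax} :: ('a, 'b) grassmann set"
  let ?T = "{gmonom A | A. Suc k \<le> card A} :: ('a, 'b) grassmann set"
  have "?S \<subseteq> m.span ?T"
  proof
    fix x assume "x \<in> ?S"
    then obtain a b where x: "x = a * b" "a \<in> gmax_power k" "b \<in> gmax" by auto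
    show "x \<in> m.span ?T" unfolding span_gmonom_iff
    proof (intro allI impI)
      fix C assume "coeff x C \<noteq> 0"
      then obtain A where A: "A \<subseteq> C" "coeff a A \<noteq> 0" "coeff b (C - A) \<noteq> 0"
        using x(1) by (auto elim: coeff_mult_nonzero)
      then have "k \<le> card A" "1 \<le> card (C - A)"
        using x Suc by (auto simp: gpart_def)
      moreover have "card A \<le> card C" by (intro card_mono) (use A in auto)
      ultimately show "Suc k \<le> card C" using A(1) by (simp add: card_Diff_subset)
    qed
  qed
  moreover have "?T \<subseteq> ?S"
  proof
    fix x assume "x \<in> ?T"
    then obtain A :: "'b set" where A: "x = gmonom A" "Suc k \<le> card A" by auto
    then have "A \<noteq> {}" by auto
    define i where "i = Max A"
    have i: "i \<in> A" "\<And>j. j \<in> A \<Longrightarrow> j \<le> i" using \<open>A \<noteq> {}\<close> by (auto simp: i_def)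
    have "sorted_list_of_set A = sorted_list_of_set (A - {i}) @ [i]"
    proof -
      have "sorted (sorted_list_of_set (A - {i}) @ [i])" "distinct (sorted_list_of_set (A - {i}) @ [i])"
        using i by (auto simp: sorted_append)
      moreover have "set (sorted_list_of_set (A - {i}) @ [i]) = A" using i by auto
      ultimately show ?thesis by (metis sorted_list_of_set.idem_if_sorted_distinct)
    qed
    then have "x = gmonom (A - {i}) * gvar i" using A by (simp add: gmonom_def)
    moreover have "(gmonom (A - {i}) :: ('a, 'b) grassmann) \<in> gmax_power k"
      unfolding Suc.IH coeff_gmonom using A(2) i(1) by simp
    moreover have "(gvar i :: ('a, 'b) grassmann) \<in> gmax" by (auto simp: gpart_def coeff_gvar)
    ultimately show "x \<in> ?S" by blast
  qed
  ultimately have "m.span ?S \<subseteq> m.span ?T \<and> m.span ?T \<subseteq> m.span ?S"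
    by (simp only: m.span_minimal m.subspace_span m.span_mono simp_thms)
  then have "m.span ?S = m.span ?T" by blast
  then show ?case by (simp only: gmax_power.simps span_gmonom_iff)
qed

definition is_alg_aut ::
    "(('k::comm_ring_1, 'n::{finite,linorder}) grassmann \<Rightarrow> ('k, 'n) grassmann) \<Rightarrow> bool"
  where "is_alg_aut \<sigma> \<longleftrightarrow> bij \<sigma> \<and> module_hom gscale gscale \<sigma> \<and> \<sigma> 1 = 1 \<and> (\<forall>a b. \<sigma> (a * b) = \<sigma> a * \<sigma> b)"

lemma linear_eqI:
  assumes "module_hom gscale gscale f" "module_hom gscale gscale g" "\<And>A. f (gmonom A) = g (gmonom A)"
  shows "f u = g u"
proof -
  interpret f: module_hom gscale gscale f by fact
  interpret g: module_hom gscale gscale g by fact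
  show ?thesis by (subst (1 2) gmonom_expansion[of u]) (simp add: f.sum g.sum f.scale g.scale assms(3))
qed

lemma alg_aut_eqI:
  assumes "is_alg_aut \<sigma>" "is_alg_aut \<tau>" "\<And>i. \<sigma> (gvar i) = \<tau> (gvar i)"
  shows "\<sigma> = \<tau>"
proof
  fix u
  have "\<sigma> (prod_list (map gvar xs)) = \<tau> (prod_list (map gvar xs))" for xs
    by (induction xs) (use assms in \<open>auto simp: is_alg_aut_def\<close>)
  then show "\<sigma> u = \<tau> u"
    using assms by - (rule linear_eqI, auto simp: is_alg_aut_def gmonom_def)
qed

text \<open>The group \<open>\<Gamma>\<close>; its multiplication is composition of maps.\<close>

definition Gam :: "(('k::comm_ring_1, 'n::{finite,linorder}) grassmann \<Rightarrow> ('k, 'n) grassmann) set"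
  where "Gam = {\<sigma>. is_alg_aut \<sigma> \<and> (\<forall>i. \<sigma> (gvar i) - gvar i \<in> godd \<inter> gmax_power 3)}"

definition is_skew_deriv ::
    "'n::{finite,linorder} \<Rightarrow> (('k::comm_ring_1, 'n) grassmann \<Rightarrow> ('k, 'n) grassmann) \<Rightarrow> bool"
  where "is_skew_deriv j D \<longleftrightarrow> module_hom gscale gscale D
    \<and> (\<forall>k. D (gvar k) = (if j = k then 1 else 0))
    \<and> (\<forall>d. \<forall>a\<in>ghomog d. \<forall>b. D (a * b) = D a * b + (-1) ^ d * a * D b)"

text \<open>The left skew derivation by \<open>x\<^sub>j\<close>; existence and uniqueness are \<open>ex1_skew_deriv\<close> below.\<close>

definition skew_deriv ::
    "'n::{finite,linorder} \<Rightarrow> ('k::comm_ring_1, 'n) grassmann \<Rightarrow> ('k, 'n) grassmann"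
  where "skew_deriv j = (THE D. is_skew_deriv j D)"

lemma is_skew_deriv_explicit:
  fixes j :: "'n::{finite,linorder}"
  defines "D \<equiv> (\<lambda>f :: ('k::comm_ring_1, 'n) grassmann.
    Grassmann (\<lambda>A. if j \<in> A then 0 else (-1) ^ card {i \<in> A. i < j} * coeff f (insert j A)))"
  shows "is_skew_deriv j D"
proof -
  have cD: "coeff (D f) A = (if j \<in> A then 0 else gsign {j} A * coeff f (insert j A))" for f A
    by (simp add: D_def gsign_singleton)
  have "module_hom gscale gscale D"
    by (intro module_hom.intro module_hom_axioms.intro module_gscale)
      (auto intro!: grassmann_eqI simp: cD algebra_simps)
  moreover have "D (gvar k) = (if j = k then 1 else 0)" for k
  proof (rule grassmann_eqI)
    fix A
    have "insert j A = {k} \<longleftrightarrow> j = k \<and> A = {}" if "j \<notin> A" using that by auto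
    then show "coeff (D (gvar k)) A = coeff (if j = k then 1 else 0) A"
      by (auto simp: cD coeff_gvar coeff_1)
  qed
  moreover have "D (a * b) = D a * b + (-1) ^ d * a * D b" if a: "a \<in> ghomog d" for d a b
  proof (rule grassmann_eqI)
    fix C
    have sc: "(-1) ^ d * a = gscale ((-1) ^ d) a"
      by (induction d) (auto intro!: grassmann_eqI)
    show "coeff (D (a * b)) C = coeff (D a * b + (-1) ^ d * a * D b) C"
    proof (cases "j \<in> C")
      case True
      have "coeff (D a * b) C = (\<Sum>A\<in>Pow C. if j \<in> A then 0 else
          gsign A (C - A) * gsign {j} A * coeff a (insert j A) * coeff b (C - A))"
        unfolding coeff_mult by (rule sum.cong) (auto simp: cD)
      also have "\<dots> = (\<Sum>A\<in>Pow (C - {j}).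
          gsign A (C - A) * gsign {j} A * coeff a (insert j A) * coeff b (C - A))"
        by (rule sum.mono_neutral_cong_right) auto
      also have "\<dots> = (\<Sum>A\<in>{A \<in> Pow C. j \<in> A}.
          gsign (A - {j}) (C - (A - {j})) * gsign {j} (A - {j}) * coeff a A * coeff b (C - (A - {j})))"
      proof (rule sum.reindex_bij_witness[where i = "\<lambda>A. A - {j}" and j = "insert j"])
        fix A assume "A \<in> Pow (C - {j})"
        then have "insert j A - {j} = A" by auto
        then show "gsign (insert j A - {j}) (C - (insert j A - {j})) * gsign {j} (insert j A - {j}) *
            coeff a (insert j A) * coeff b (C - (insert j A - {j}))
          = gsign A (C - A) * gsign {j} A * coeff a (insert j A) * coeff b (C - A)" by simp
      qed (use True in auto)
      finally have L: "coeff (D a * b) C = \<dots>" .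
      have "coeff (gscale ((-1) ^ d) a * D b) C = (\<Sum>A\<in>Pow C. if j \<notin> A then 0 else
          gsign A (C - A) * ((-1) ^ d * coeff a A) * (gsign {j} (C - A) * coeff b (insert j (C - A))))"
        unfolding coeff_mult by (rule sum.cong) (use True in \<open>auto simp: cD\<close>)
      also have "\<dots> = (\<Sum>A\<in>{A \<in> Pow C. j \<in> A}.
          gsign A (C - A) * ((-1) ^ d * coeff a A) * (gsign {j} (C - A) * coeff b (insert j (C - A))))"
        by (rule sum.mono_neutral_cong_right) auto
      also have "\<dots> = (\<Sum>A\<in>{A \<in> Pow C. j \<in> A}. -
          (gsign (A - {j}) (C - (A - {j})) * gsign {j} (A - {j}) * coeff a A * coeff b (C - (A - {j}))))"
      proof (rule sum.cong[OF refl])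
        fix A assume "A \<in> {A \<in> Pow C. j \<in> A}"
        then have A: "A \<subseteq> C" "j \<in> A" by auto
        define B E where "B = A - {j}" and "E = C - A"
        have BE: "A = insert j B" "C - A = E" "C - B = insert j E" "insert j (C - A) = insert j E" "A - {j} = B"
          "j \<notin> B" "j \<notin> E" using A by (auto simp: B_def E_def)
        have g: "gsign A E = gsign {j} E * (gsign B E :: 'k)" "gsign B (insert j E) = gsign B {j} * (gsign B E :: 'k)"
          using gsign_Un_left[of "{j}" B E] gsign_Un_right[of "{j}" E B] BE by auto
        have sq: "gsign {j} E * gsign {j} E = (1 :: 'k)" by simp
        have "gsign B {j} * gsign {j} B = ((-1) ^ card B :: 'k)"
          using BE(6) by (rule gsign_swap)
        moreover have "(-1) ^ d * coeff a A = - ((-1) ^ card B) * coeff a A"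
        proof (cases "coeff a A = 0")
          case False
          then have "d = card A" using a by (auto simp: gpart_def)
          then have "d = Suc (card B)" using BE by simp
          then show ?thesis by simp
        qed simp
        ultimately have 1: "(-1) ^ d * coeff a A = - (gsign B {j} * gsign {j} B * coeff a A)" by simp
        have "gsign A E * ((-1) ^ d * coeff a A) * (gsign {j} E * coeff b (insert j E))
          = (gsign {j} E * gsign {j} E) * gsign B E * ((-1) ^ d * coeff a A) * coeff b (insert j E)"
          by (simp add: g mult_ac)
        also have "\<dots> = - (gsign B (insert j E) * gsign {j} B * coeff a A * coeff b (insert j E))"
          unfolding sq 1 g by (simp add: mult_ac)
        finally show "gsign A (C - A) * ((-1) ^ d * coeff a A) * (gsign {j} (C - A) * coeff b (insert j (C - A)))
          = - (gsign (A - {j}) (C - (A - {j})) * gsign {j} (A - {j}) * coeff a A * coeff b (C - (A - {j})))"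
          by (simp only: BE(2-5))
      qed
      also have "\<dots> = - coeff (D a * b) C" by (simp add: L sum_negf)
      finally show ?thesis using True by (simp add: sc cD)
    next
      case False
      have "Pow (insert j C) = Pow C \<union> insert j ` Pow C" by (rule Pow_insert)
      then have "coeff (a * b) (insert j C) =
          (\<Sum>A\<in>Pow C. gsign A (insert j C - A) * coeff a A * coeff b (insert j C - A)) +
          (\<Sum>A\<in>insert j ` Pow C. gsign A (insert j C - A) * coeff a A * coeff b (insert j C - A))"
        unfolding coeff_mult using False by (simp only:) (rule sum.union_disjoint, auto)
      also have "(\<Sum>A\<in>insert j ` Pow C. gsign A (insert j C - A) * coeff a A * coeff b (insert j C - A)) =
          (\<Sum>A\<in>Pow C. gsign (insert j A) (C - A) * coeff a (insert j A) * coeff b (C - A))"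
      proof (rule sum.reindex_cong[of "insert j"])
        show "inj_on (insert j) (Pow C)" using False by (intro inj_onI) (metis PowD insert_ident subsetD)
        fix A assume "A \<in> Pow C"
        then have "insert j C - insert j A = C - A" using False by auto
        then show "gsign (insert j A) (insert j C - insert j A) * coeff a (insert j A) * coeff b (insert j C - insert j A)
          = gsign (insert j A) (C - A) * coeff a (insert j A) * coeff b (C - A)" by simp
      qed simp
      finally have "coeff (D (a * b)) C =
          (\<Sum>A\<in>Pow C. gsign {j} C * (gsign A (insert j C - A) * coeff a A * coeff b (insert j C - A))) +
          (\<Sum>A\<in>Pow C. gsign {j} C * (gsign (insert j A) (C - A) * coeff a (insert j A) * coeff b (C - A)))"
        using False by (simp add: cD sum_distrib_left distrib_left)
      also have "(\<Sum>A\<in>Pow C. gsign {j} C * (gsign (insert j A) (C - A) * coeff a (insert j A) * coeff b (C - A)))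
          = coeff (D a * b) C"
        unfolding coeff_mult
      proof (rule sum.cong[OF refl])
        fix A assume "A \<in> Pow C"
        then have A: "A \<subseteq> C" "j \<notin> A" "j \<notin> C - A" using False by auto
        have sq: "gsign {j} (C - A) * gsign {j} (C - A) = (1 :: 'k)" by simp
        have s1: "gsign {j} C = gsign {j} A * (gsign {j} (C - A) :: 'k)"
          using gsign_Un_right[of A "C - A" "{j}"] A by (simp add: Un_absorb1)
        have s2: "gsign (insert j A) (C - A) = gsign {j} (C - A) * (gsign A (C - A) :: 'k)"
          using gsign_Un_left[of "{j}" A "C - A"] A by simp
        have "gsign {j} C * (gsign (insert j A) (C - A) * coeff a (insert j A) * coeff b (C - A))
          = (gsign {j} (C - A) * gsign {j} (C - A)) * gsign A (C - A) * gsign {j} A * coeff a (insert j A) * coeff b (C - A)"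
          unfolding s1 s2 by (simp add: mult_ac)
        then show "gsign {j} C * (gsign (insert j A) (C - A) * coeff a (insert j A) * coeff b (C - A))
          = gsign A (C - A) * coeff (D a) A * coeff b (C - A)"
          using A by (simp add: sq cD mult_ac)
      qed
      also have "(\<Sum>A\<in>Pow C. gsign {j} C * (gsign A (insert j C - A) * coeff a A * coeff b (insert j C - A)))
          = coeff (gscale ((-1) ^ d) a * D b) C"
        unfolding coeff_mult
      proof (rule sum.cong[OF refl])
        fix A assume "A \<in> Pow C"
        then have A: "A \<subseteq> C" "j \<notin> A" "j \<notin> C - A" "insert j C - A = insert j (C - A)" using False by auto
        have s1: "gsign {j} C = gsign {j} A * (gsign {j} (C - A) :: 'k)"
          using gsign_Un_right[of A "C - A" "{j}"] A by (simp add: Un_absorb1)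
        have s2: "gsign A (insert j (C - A)) = gsign A {j} * (gsign A (C - A) :: 'k)"
          using gsign_Un_right[of "{j}" "C - A" A] A by simp
        have "gsign A {j} * gsign {j} A = ((-1) ^ card A :: 'k)"
          using A(2) by (rule gsign_swap)
        moreover have "(-1) ^ d * coeff a A = (-1) ^ card A * coeff a A"
          using a by (cases "coeff a A = 0") (auto simp: gpart_def)
        ultimately have 1: "gsign A {j} * gsign {j} A * coeff a A = (-1) ^ d * coeff a A" by simp
        have "gsign {j} C * (gsign A (insert j (C - A)) * coeff a A * coeff b (insert j (C - A)))
          = gsign A (C - A) * (gsign A {j} * gsign {j} A * coeff a A) * (gsign {j} (C - A) * coeff b (insert j (C - A)))"
          unfolding s1 s2 by (simp only: mult_ac)
        then show "gsign {j} C * (gsign A (insert j C - A) * coeff a A * coeff b (insert j C - A))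
          = gsign A (C - A) * coeff (gscale ((-1) ^ d) a) A * coeff (D b) (C - A)"
          unfolding 1 A(4) using A(3) False by (simp add: cD)
      qed
      finally show ?thesis by (simp add: sc)
    qed
  qed
  ultimately show ?thesis by (simp add: is_skew_deriv_def)
qed

lemma is_skew_deriv_unique:
  fixes D D' :: "('k::comm_ring_1, 'n::{finite,linorder}) grassmann \<Rightarrow> ('k, 'n) grassmann"
  assumes "is_skew_deriv j D" "is_skew_deriv j D'"
  shows "D = D'"
proof
  fix u
  have 1: "E 1 = 0" if "is_skew_deriv j E" for E :: "('k, 'n) grassmann \<Rightarrow> ('k, 'n) grassmann"
  proof -
    have "1 \<in> ghomog 0" by (auto simp: gpart_def coeff_1)
    then have "E (1 * 1) = E 1 * 1 + (-1) ^ 0 * 1 * E 1" using that unfolding is_skew_deriv_def by blast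
    then show ?thesis by simp
  qed
  have v: "gvar i \<in> ghomog 1" for i by (auto simp: gpart_def coeff_gvar)
  have "D (prod_list (map gvar xs)) = D' (prod_list (map gvar xs))" for xs
  proof (induction xs)
    case Nil
    then show ?case using 1[OF assms(1)] 1[OF assms(2)] by simp
  next
    case (Cons i xs)
    have "E (gvar i * b) = (if j = i then 1 else 0) * b + (-1) ^ 1 * gvar i * E b"
      if "is_skew_deriv j E" for E :: "('k, 'n) grassmann \<Rightarrow> ('k, 'n) grassmann" and b
    proof -
      have "E (gvar i * b) = E (gvar i) * b + (-1) ^ 1 * gvar i * E b"
        using that v[of i] unfolding is_skew_deriv_def by blast
      moreover have "E (gvar i) = (if j = i then 1 else 0)"
        using that unfolding is_skew_deriv_def by blast
      ultimately show ?thesis by simp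
    qed
    from this[OF assms(1)] this[OF assms(2)] show ?case by (simp add: Cons.IH)
  qed
  then show "D u = D' u"
    using assms by - (rule linear_eqI, auto simp: is_skew_deriv_def gmonom_def)
qed

lemma ex1_skew_deriv: "\<exists>!D. is_skew_deriv j D"
  using is_skew_deriv_explicit is_skew_deriv_unique by blast

lemma coeff_skew_deriv:
  fixes f :: "('k::comm_ring_1, 'n::{finite,linorder}) grassmann"
  shows "coeff (skew_deriv j f) A = (if j \<in> A then 0 else (-1) ^ card {i \<in> A. i < j} * coeff f (insert j A))"
proof -
  have "skew_deriv j = (\<lambda>f :: ('k, 'n) grassmann. Grassmann (\<lambda>A. if j \<in> A then 0 else (-1) ^ card {i \<in> A. i < j} * coeff f (insert j A)))"
    unfolding skew_deriv_def by (rule the1_equality) (rule ex1_skew_deriv, rule is_skew_deriv_explicit)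
  then show ?thesis by simp
qed

text \<open>
  The Leibniz expansion of \<open>det (\<partial>\<sigma>(x\<^sub>i)/\<partial>x\<^sub>j)\<close>.  For \<open>\<sigma>\<close> in \<open>\<Gamma>\<close> the entries are even, hence commute,
  so the determinant is over a commutative ring; the product is nevertheless written as an ordered
  one because the whole algebra is not commutative.
\<close>

definition jac :: "(('k::comm_ring_1, 'n::{finite,linorder}) grassmann \<Rightarrow> ('k, 'n) grassmann)
    \<Rightarrow> ('k, 'n) grassmann"
  where "jac \<sigma> = (\<Sum>p | p permutes UNIV. of_int (sign p) *
    prod_list (map (\<lambda>i. skew_deriv (p i) (\<sigma> (gvar i))) (sorted_list_of_set UNIV)))"

text \<open>\<open>even_units\<close> is \<open>E'\<^sub>n\<close>, and \<open>even_units_ge k\<close> is \<open>E'\<^bsub>n,k\<^esub>\<close> (for even \<open>k \<ge> 2\<close>).\<close>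

definition even_units :: "('k::comm_ring_1, 'n::{finite,linorder}) grassmann set"
  where "even_units = (\<lambda>f. 1 + f) ` gpart {2 * m | m. 1 \<le> m}"

definition even_units_ge :: "nat \<Rightarrow> ('k::comm_ring_1, 'n::{finite,linorder}) grassmann set"
  where "even_units_ge k = even_units \<inter> (\<lambda>f. 1 + f) ` gmax_power k"

text \<open>Congruence modulo \<open>E'\<^bsub>n,k\<^esub>\<close> is a relation on \<open>E'\<^sub>n\<close>: both sides are required to lie there.\<close>

definition even_units_cong ::
    "('k::comm_ring_1, 'n::{finite,linorder}) grassmann \<Rightarrow> ('k, 'n) grassmann \<Rightarrow> nat \<Rightarrow> bool"
  where "even_units_cong u v k \<longleftrightarrow> u \<in> even_units \<and> v \<in> even_units
    \<and> (\<lambda>w. u * w) ` even_units_ge k = (\<lambda>w. v * w) ` even_units_ge k"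

definition Gam_ge ::
    "nat \<Rightarrow> (('k::comm_ring_1, 'n::{finite,linorder}) grassmann \<Rightarrow> ('k, 'n) grassmann) set"
  where "Gam_ge k = {\<sigma> \<in> Gam. jac \<sigma> \<in> even_units_ge k}"

definition Sig :: "(('k::comm_ring_1, 'n::{finite,linorder}) grassmann \<Rightarrow> ('k, 'n) grassmann) set"
  where "Sig = {\<sigma> \<in> Gam. jac \<sigma> = 1}"

text \<open>
  The indices \<open>1, \<dots>, n\<close> are the positions of the elements of the index type, so
  \<open>{i + 1, \<dots>, n}\<close> is \<open>{i<..}\<close>.
\<close>

definition pos :: "'n::{finite,linorder} \<Rightarrow> nat"
  where "pos i = card {..i}"

text \<open>
  \<open>tail_space s i\<close> consists of the combinations of monomials \<open>x\<^sup>A\<close> with \<open>|A| = 2s\<close>, \<open>i \<notin> A\<close> and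
  \<open>{i + 1, \<dots>, n} \<subseteq> A\<close>.  The decomposition of \<open>a\<close> exists and is unique by
  \<open>ex1_tail_decomposition\<close> below; as a family it is extended by \<open>undefined\<close> outside its index range.
\<close>

definition tail_space :: "nat \<Rightarrow> 'n::{finite,linorder} \<Rightarrow> ('k::comm_ring_1, 'n) grassmann set"
  where "tail_space s i =
    module.span gscale {gmonom A | A. card A = 2 * s \<and> i \<notin> A \<and> {i<..} \<subseteq> A}"

definition is_tail_decomposition :: "nat \<Rightarrow> ('k::comm_ring_1, 'n::{finite,linorder}) grassmann
    \<Rightarrow> ('n \<Rightarrow> ('k, 'n) grassmann) \<Rightarrow> bool"
  where "is_tail_decomposition s a c \<longleftrightarrow>
    c \<in> (\<Pi>\<^sub>E i \<in> {i. CARD('n) - 2 * s \<le> pos i}. tail_space s i)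
    \<and> a = (\<Sum>i | CARD('n) - 2 * s \<le> pos i. c i)"

definition tail_component :: "nat \<Rightarrow> ('k::comm_ring_1, 'n::{finite,linorder}) grassmann
    \<Rightarrow> 'n \<Rightarrow> ('k, 'n) grassmann"
  where "tail_component s a = (THE c. is_tail_decomposition s a c)"

lemma tail_index_unique:
  fixes A :: "'n::{finite,linorder} set"
  assumes "card A = 2 * s" "2 * s < CARD('n)"
  shows "\<exists>!i. i \<notin> A \<and> {i<..} \<subseteq> A" and "i \<notin> A \<Longrightarrow> {i<..} \<subseteq> A \<Longrightarrow> CARD('n) - 2 * s \<le> pos i"
proof -
  have "A \<noteq> UNIV" using assms by auto
  then have "- A \<noteq> {}" by blast
  then have m: "Max (- A) \<in> - A" by (intro Max_in) auto
  have sub: "{Max (- A)<..} \<subseteq> A"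
  proof
    fix k assume k: "k \<in> {Max (- A)<..}"
    have "k \<le> Max (- A)" if "k \<notin> A" using that by (intro Max_ge) auto
    then show "k \<in> A" using k by fastforce
  qed
  show "\<exists>!i. i \<notin> A \<and> {i<..} \<subseteq> A"
  proof (rule ex1I)
    show "Max (- A) \<notin> A \<and> {Max (- A)<..} \<subseteq> A" using m sub by simp
    fix i assume i: "i \<notin> A \<and> {i<..} \<subseteq> A"
    show "i = Max (- A)"
    proof (cases i "Max (- A)" rule: linorder_cases)
      case less
      then show ?thesis using i m by blast
    next
      case greater
      then show ?thesis using i sub by blast
    qed
  qed
  show "CARD('n) - 2 * s \<le> pos i" if "{i<..} \<subseteq> A"
  proof -
    have "card {i<..} \<le> 2 * s" using card_mono[OF _ that] assms by simp
    moreover have "{..i} \<union> {i<..} = UNIV" "{..i} \<inter> {i<..} = {}" by auto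
    then have "CARD('n) = card {..i} + card {i<..}"
      using card_Un_disjoint[of "{..i}" "{i<..}"] by simp
    ultimately show ?thesis by (simp add: pos_def)
  qed
qed

lemma ex1_tail_decomposition:
  fixes a :: "('k::comm_ring_1, 'n::{finite,linorder}) grassmann"
  assumes "a \<in> ghomog (2 * s)" "2 * s < CARD('n)"
  shows "\<exists>!c. is_tail_decomposition s a c"
proof -
  let ?I = "{i :: 'n. CARD('n) - 2 * s \<le> pos i}"
  define c where "c = (\<lambda>i. if i \<in> ?I then
    Grassmann (\<lambda>A. if i \<notin> A \<and> {i<..} \<subseteq> A then coeff a A else 0) else undefined)"
  have coeff_tail: "coeff (d i) A = (if i \<notin> A \<and> {i<..} \<subseteq> A then coeff a A else 0)"
    if "is_tail_decomposition s a d" "i \<in> ?I" for d i A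
  proof (cases "card A = 2 * s \<and> i \<notin> A \<and> {i<..} \<subseteq> A")
    case True
    have "coeff a A = (\<Sum>k\<in>?I. coeff (d k) A)" using that by (simp add: is_tail_decomposition_def)
    also have "\<dots> = (\<Sum>k\<in>?I. if k = i then coeff (d i) A else 0)"
    proof (rule sum.cong[OF refl])
      fix k assume "k \<in> ?I"
      then have "d k \<in> tail_space s k" using that by (auto simp: is_tail_decomposition_def)
      moreover have "k = i" if "k \<notin> A" "{k<..} \<subseteq> A" 
        using tail_index_unique(1)[of A s] True that assms(2) by blast
      ultimately show "coeff (d k) A = (if k = i then coeff (d i) A else 0)"
        unfolding tail_space_def span_gmonom_iff by (cases "k = i") auto
    qed
    finally show ?thesis using True that(2) by (simp add: sum.delta)
  next
    case False
    have "d i \<in> tail_space s i" using that by (auto simp: is_tail_decomposition_def)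
    then have "coeff (d i) A = 0" using False unfolding tail_space_def span_gmonom_iff by blast
    moreover have "coeff a A = 0" if "i \<notin> A" "{i<..} \<subseteq> A"
      using False that assms(1) by (auto simp: gpart_def)
    ultimately show ?thesis by simp
  qed
  have "is_tail_decomposition s a c"
  proof -
    have "c \<in> (\<Pi>\<^sub>E i \<in> ?I. tail_space s i)"
      using assms(1) by (auto simp: c_def tail_space_def span_gmonom_iff gpart_def split: if_splits)
    moreover have "a = (\<Sum>i\<in>?I. c i)"
    proof (rule grassmann_eqI)
      fix A
      have e: "coeff (\<Sum>i\<in>?I. c i) A = (\<Sum>i\<in>?I. if i \<notin> A \<and> {i<..} \<subseteq> A then coeff a A else 0)"
        by (simp add: c_def)
      show "coeff a A = coeff (\<Sum>i\<in>?I. c i) A"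
      proof (cases "coeff a A = 0")
        case False
        then have "card A = 2 * s" using assms(1) by (auto simp: gpart_def)
        from tail_index_unique[OF this assms(2)]
        obtain k where k: "k \<in> ?I" "\<And>i. i \<notin> A \<and> {i<..} \<subseteq> A \<longleftrightarrow> i = k" by blast
        then show ?thesis unfolding e by (simp add: sum.delta)
      next
        case True
        then show ?thesis unfolding e by (simp only: True if_cancel sum.neutral_const)
      qed
    qed
    ultimately show ?thesis by (simp add: is_tail_decomposition_def)
  qed
  moreover have "d = c" if "is_tail_decomposition s a d" for d
  proof
    fix i
    show "d i = c i"
    proof (cases "i \<in> ?I")
      case True
      then show ?thesis using that by (intro grassmann_eqI) (simp add: coeff_tail c_def)
    next
      case False
      moreover have "d \<in> (\<Pi>\<^sub>E i \<in> ?I. tail_space s i)" using that by (simp add: is_tail_decomposition_def)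
      ultimately have "d i = undefined" by (rule PiE_arb[rotated])
      then show ?thesis using False by (simp only: c_def if_False)
    qed
  qed
  ultimately show ?thesis by blast
qed

text \<open>
  The automorphism \<open>\<phi>'\<^sub>a\<close> for \<open>a\<close> homogeneous of degree \<open>2s\<close>.  The degree is a parameter, but for
  \<open>a \<noteq> 0\<close> it is determined by \<open>a\<close>, and for \<open>a = 0\<close> the map is the identity whatever \<open>s\<close> is.
  An algebra automorphism is determined by its values on the generators (\<open>alg_aut_eqI\<close>).
\<close>

definition phi' :: "nat \<Rightarrow> ('k::comm_ring_1, 'n::{finite,linorder}) grassmann
    \<Rightarrow> ('k, 'n) grassmann \<Rightarrow> ('k, 'n) grassmann"
  where "phi' s a = (THE \<phi>. \<phi> \<in> Gam \<and> (\<forall>i. \<phi> (gvar i) =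
    (if CARD('n) - 2 * s \<le> pos i then gvar i * (1 + tail_component s a i) else gvar i)))"

definition phi'_product :: "nat \<Rightarrow> (nat \<Rightarrow> ('k::comm_ring_1, 'n::{finite,linorder}) grassmann)
    \<Rightarrow> ('k, 'n) grassmann \<Rightarrow> ('k, 'n) grassmann"
  where "phi'_product m a = foldr (\<circ>) (map (\<lambda>s. phi' s (a s)) [1..<Suc m]) id"

text \<open>
  \<open>a s\<close> is the element written \<open>a(2s)\<close>; the family is \<open>undefined\<close> outside its index range, so that
  uniqueness of the family is equality of functions.
\<close>

definition is_factorization ::
    "(('k::comm_ring_1, 'n::{finite,linorder}) grassmann \<Rightarrow> ('k, 'n) grassmann)
      \<Rightarrow> (nat \<Rightarrow> ('k, 'n) grassmann) \<Rightarrow> (('k, 'n) grassmann \<Rightarrow> ('k, 'n) grassmann) \<Rightarrow> bool"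
  where "is_factorization \<sigma> a \<gamma> \<longleftrightarrow>
    a \<in> (\<Pi>\<^sub>E s \<in> {1..(CARD('n) - 1) div 2}. ghomog (2 * s))
    \<and> \<gamma> \<in> Gam_ge (2 * ((CARD('n) - 1) div 2) + 2)
    \<and> \<sigma> = phi'_product ((CARD('n) - 1) div 2) a \<circ> \<gamma>"

end

theory Submission
  imports Defs "HOL-Analysis.Determinants"
begin

text \<open>
  The Jacobian is a cocycle, \<open>J(\<sigma>\<tau>) = J(\<sigma>) \<sigma>(J(\<tau>))\<close>, and
  \<open>J(\<phi>'\<^sub>a) \<equiv> 1 + a\<close> modulo degree \<open>2s + 2\<close> when \<open>a\<close> has degree \<open>2s\<close>: the Jacobian matrix of
  \<open>\<phi>'\<^sub>a\<close> is the identity up to degree \<open>2s\<close>, so to first order its determinant is given by the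
  trace, and \<open>x\<^sub>i\<close> does not occur in \<open>a\<^sub>i\<close>.  Hence the leading term of \<open>J(\<sigma>) - 1\<close> determines the
  next factor, and dividing by this factor raises the order of \<open>J(\<sigma>) - 1\<close> by two.

  For even \<open>n\<close> this process stops at \<open>J(\<gamma>) = 1 + c x\<^sub>1\<cdots>x\<^sub>n\<close>.  That \<open>c = 0\<close> follows from the
  change of variables formula for the Berezin integral (the coefficient of \<open>x\<^sub>1\<cdots>x\<^sub>n\<close>),
  \<open>\<integral> \<sigma>(f) J(\<sigma>)\<^sup>-\<^sup>1 = \<integral> f\<close>, for \<open>f = 1\<close>.  Both sides are compatible with composition, so it is enough
  to check it for automorphisms moving a single generator, and these generate \<open>\<Gamma>\<close>.
\<close>

section \<open>Parity, degree and skew derivations\<close>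

abbreviation geven :: "('k::comm_ring_1, 'n) grassmann set"
  where "geven \<equiv> gpart {d. even d}"

section \<open>Closure properties of graded parts and of powers of the maximal ideal\<close>

lemma gpart_0 [simp]: "0 \<in> gpart D"
  by (simp add: gpart_def)

lemma gpart_add: "f \<in> gpart D \<Longrightarrow> g \<in> gpart D \<Longrightarrow> f + g \<in> gpart D"
  unfolding gpart_def by simp (metis add.right_neutral add.left_neutral)

lemma gpart_uminus: "f \<in> gpart D \<Longrightarrow> - f \<in> gpart D"
  by (simp add: gpart_def)

lemma gpart_diff: "f \<in> gpart D \<Longrightarrow> g \<in> gpart D \<Longrightarrow> f - g \<in> gpart D"
  using gpart_add[of f D "- g"] gpart_uminus[of g D] by simp

lemma gpart_sum: "(\<And>i. i \<in> I \<Longrightarrow> f i \<in> gpart D) \<Longrightarrow> (\<Sum>i\<in>I. f i) \<in> gpart D"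
  by (induction I rule: infinite_finite_induct) (auto intro: gpart_add)

lemma gmax_power_0 [simp]: "0 \<in> gmax_power k"
  by (simp add: gmax_power_iff)

lemma gmax_power_add: "f \<in> gmax_power k \<Longrightarrow> g \<in> gmax_power k \<Longrightarrow> f + g \<in> gmax_power k"
  unfolding gmax_power_iff by simp (metis add.right_neutral add.left_neutral)

lemma gmax_power_uminus: "f \<in> gmax_power k \<Longrightarrow> - f \<in> gmax_power k"
  by (simp add: gmax_power_iff)

lemma gmax_power_diff: "f \<in> gmax_power k \<Longrightarrow> g \<in> gmax_power k \<Longrightarrow> f - g \<in> gmax_power k"
  using gmax_power_add[of f k "- g"] gmax_power_uminus[of g k] by simp

lemma gmax_power_diff_commute: "f - g \<in> gmax_power k \<Longrightarrow> g - f \<in> gmax_power k"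
  using gmax_power_uminus[of "f - g" k] by simp

lemma gmax_power_sum: "(\<And>i. i \<in> I \<Longrightarrow> f i \<in> gmax_power k) \<Longrightarrow> (\<Sum>i\<in>I. f i) \<in> gmax_power k"
  by (induction I rule: infinite_finite_induct) (auto intro: gmax_power_add simp del: gmax_power.simps)

lemma gmax_power_mono: "f \<in> gmax_power k \<Longrightarrow> j \<le> k \<Longrightarrow> f \<in> gmax_power j"
  unfolding gmax_power_iff using order_trans by blast

lemma gmax_power_mult:
  assumes "f \<in> gmax_power j" "g \<in> gmax_power k" shows "f * g \<in> gmax_power (j + k)"
  unfolding gmax_power_iff
proof (intro allI impI)
  fix C assume "coeff (f * g) C \<noteq> 0"
  then obtain A where A: "A \<subseteq> C" "coeff f A \<noteq> 0" "coeff g (C - A) \<noteq> 0"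
    by (rule coeff_mult_nonzero)
  then have "j \<le> card A" "k \<le> card (C - A)" using assms by (auto simp: gmax_power_iff)
  moreover have "card C = card A + card (C - A)"
    using A(1) by (simp add: card_Diff_subset card_mono)
  ultimately show "j + k \<le> card C" by simp
qed

lemma gmax_power_multL: "f \<in> gmax_power k \<Longrightarrow> f * g \<in> gmax_power k"
  using gmax_power_mult[of f k g 0] by simp

lemma gmax_power_multR: "g \<in> gmax_power k \<Longrightarrow> f * g \<in> gmax_power k"
  using gmax_power_mult[of f 0 g k] by simp

lemma gmax_power_trivial:
  fixes f :: "('k::comm_ring_1, 'n::{finite,linorder}) grassmann"
  assumes "f \<in> gmax_power k" "CARD('n) < k" shows "f = 0"
proof (rule grassmann_eqI)
  fix A :: "'n set"
  have "card A \<le> CARD('n)" by (intro card_mono) auto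
  then show "coeff f A = coeff 0 A" using assms unfolding gmax_power_iff by fastforce
qed

lemma gpart_mult:
  assumes "f \<in> gpart D" "g \<in> gpart E" "\<And>d e. d \<in> D \<Longrightarrow> e \<in> E \<Longrightarrow> d + e \<in> F"
  shows "f * g \<in> gpart F"
  unfolding gpart_def
proof (intro CollectI allI impI)
  fix C assume "coeff (f * g) C \<noteq> 0"
  then obtain A where A: "A \<subseteq> C" "coeff f A \<noteq> 0" "coeff g (C - A) \<noteq> 0"
    by (rule coeff_mult_nonzero)
  then have "card A + card (C - A) \<in> F" using assms by (auto simp: gpart_def)
  moreover have "card C = card A + card (C - A)"
    using A(1) by (simp add: card_Diff_subset card_mono)
  ultimately show "card C \<in> F" by simp
qed

lemma geven_mult: "f \<in> geven \<Longrightarrow> g \<in> geven \<Longrightarrow> f * g \<in> geven"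
  and geven_godd_mult: "f \<in> geven \<Longrightarrow> g \<in> godd \<Longrightarrow> f * g \<in> godd"
  and godd_geven_mult: "f \<in> godd \<Longrightarrow> g \<in> geven \<Longrightarrow> f * g \<in> godd"
  and godd_mult: "f \<in> godd \<Longrightarrow> g \<in> godd \<Longrightarrow> f * g \<in> geven"
  by (auto elim!: gpart_mult)

lemma geven_1 [simp]: "1 \<in> geven"
  by (simp add: gpart_def coeff_1)

lemma geven_of_int [simp]: "of_int k \<in> geven"
proof -
  have n: "of_nat m \<in> geven" for m by (induction m) (auto intro: gpart_add)
  show ?thesis by (cases k) (auto intro: n gpart_uminus gpart_diff simp del: of_nat_Suc)
qed

lemma geven_prod_list: "(\<And>x. x \<in> set xs \<Longrightarrow> x \<in> geven) \<Longrightarrow> prod_list xs \<in> geven"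
  by (induction xs) (auto intro: geven_mult)

lemma godd_gvar [simp]: "gvar i \<in> godd"
  by (simp add: gpart_def coeff_gvar)

lemma gmax_power_gvar [simp]: "gvar i \<in> gmax_power 1"
  unfolding gmax_power_iff by (simp add: coeff_gvar)

lemma parity_decomposition:
  obtains f0 f1 where "f0 \<in> geven" "f1 \<in> godd" "f = f0 + f1"
proof
  show "Grassmann (\<lambda>A. if even (card A) then coeff f A else 0) \<in> geven"
    "Grassmann (\<lambda>A. if odd (card A) then coeff f A else 0) \<in> godd"
    by (auto simp: gpart_def)
  show "f = Grassmann (\<lambda>A. if even (card A) then coeff f A else 0)
    + Grassmann (\<lambda>A. if odd (card A) then coeff f A else 0)"
    by (rule grassmann_eqI) auto
qed

text \<open>Each pair in \<open>A \<times> B\<close> is an inversion for exactly one of the two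
  orders, so the two exponents add up to \<open>card A * card B\<close>; a sign is its own
  inverse.\<close>

lemma gsign_commute:
  assumes "A \<inter> B = {}"
  shows "gsign A B = ((-1) ^ (card A * card B) * gsign B A :: 'k::comm_ring_1)"
proof -
  define S T where "S = {(i, j). i \<in> A \<and> j \<in> B \<and> j < i}" and "T = {(i, j). i \<in> B \<and> j \<in> A \<and> j < i}"
  have "S \<union> prod.swap ` T = A \<times> B"
    using assms by (auto simp: S_def T_def image_iff)
  moreover have "card (S \<union> prod.swap ` T) = card S + card (prod.swap ` T)"
    by (rule card_Un_disjoint) (auto simp: S_def T_def)
  moreover have "card (prod.swap ` T) = card T"
    by (rule card_image) (auto intro: inj_onI)
  ultimately have c: "card A * card B = card S + card T" by (simp add: card_cartesian_product)
  have "(-1) ^ (card A * card B) * gsign B A = (gsign A B * (gsign B A * gsign B A) :: 'k)"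
    unfolding c by (simp add: power_add gsign_def S_def T_def mult.assoc)
  then show ?thesis by simp
qed

text \<open>Passing to complements in \<open>C\<close> exchanges the factors in the coefficient at
  \<open>C\<close>. A constant sign on the supports covers both an even factor and a pair of odd
  ones.\<close>

lemma mult_commute_sign:
  assumes "\<And>A B. coeff f A \<noteq> 0 \<Longrightarrow> coeff g B \<noteq> 0 \<Longrightarrow> (-1) ^ (card A * card B) = (c :: 'k::comm_ring_1)"
  shows "f * g = gscale c (g * f)"
proof (rule grassmann_eqI)
  fix C
  have "coeff (f * g) C = (\<Sum>A\<in>Pow C. gsign (C - A) A * coeff f (C - A) * coeff g A)"
    unfolding coeff_mult
    by (rule sum.reindex_bij_witness[where i = "\<lambda>A. C - A" and j = "\<lambda>A. C - A"]) (auto simp: double_diff)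
  also have "\<dots> = (\<Sum>A\<in>Pow C. c * (gsign A (C - A) * coeff g A * coeff f (C - A)))"
  proof (rule sum.cong[OF refl])
    fix A
    show "gsign (C - A) A * coeff f (C - A) * coeff g A = c * (gsign A (C - A) * coeff g A * coeff f (C - A))"
    proof (cases "coeff f (C - A) = 0 \<or> coeff g A = 0")
      case False
      then have "(-1) ^ (card (C - A) * card A) = c" by (intro assms) auto
      moreover have "(C - A) \<inter> A = {}" by auto
      ultimately show ?thesis using gsign_commute[of "C - A" A, where 'k = 'k] by (simp add: mult_ac)
    qed auto
  qed
  also have "\<dots> = coeff (gscale c (g * f)) C" by (simp add: coeff_mult sum_distrib_left)
  finally show "coeff (f * g) C = coeff (gscale c (g * f)) C" .
qed

lemma gscale_1 [simp]: "gscale 1 f = f" and gscale_minus_1 [simp]: "gscale (-1) f = - f"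
  by (auto intro: grassmann_eqI)

lemma geven_commute: "f \<in> geven \<Longrightarrow> f * g = g * f"
  using mult_commute_sign[of f g 1] by (auto simp: gpart_def)

lemma godd_anticommute: "f \<in> godd \<Longrightarrow> g \<in> godd \<Longrightarrow> f * g = - (g * f)"
  using mult_commute_sign[of f g "-1"] by (auto simp: gpart_def)

lemma gmonom_square:
  assumes "A \<noteq> {}" shows "gmonom A * gmonom A = 0"
proof (rule grassmann_eqI)
  fix C
  show "coeff (gmonom A * gmonom A) C = coeff 0 C"
    unfolding coeff_mult coeff_gmonom coeff_0
  proof (intro sum.neutral ballI)
    fix B
    have "B \<noteq> A \<or> C - B \<noteq> A" using assms by auto
    then show "gsign B (C - B) * (if B = A then 1 else 0) * (if C - B = A then 1 else 0) = 0" by auto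
  qed
qed

text \<open>In characteristic 2 this does not follow from anticommutativity.\<close>

lemma godd_square:
  fixes f :: "('k::comm_ring_1, 'n::{finite,linorder}) grassmann"
  assumes "f \<in> godd" shows "f * f = 0"
proof -
  let ?t = "\<lambda>A. gscale (coeff f A) (gmonom A) :: ('k, 'n) grassmann"
  have o: "?t A \<in> godd" for A using assms by (auto simp: gpart_def coeff_gmonom)
  have sq: "?t A * ?t A = 0" for A
  proof (cases "A = {}")
    case True
    then have "coeff f A = 0" using assms by (auto simp: gpart_def)
    then show ?thesis by (auto intro: grassmann_eqI simp: gscale_mult)
  next
    case False
    then show ?thesis by (auto intro: grassmann_eqI simp: gscale_mult gmonom_square)
  qed
  have "(\<Sum>A\<in>I. ?t A) * (\<Sum>A\<in>I. ?t A) = 0" if "finite I" for I :: "'n set set"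
    using that
  proof induction
    case (insert A I)
    have "(\<Sum>A\<in>I. ?t A) \<in> godd" by (intro gpart_sum o)
    then have "?t A * (\<Sum>A\<in>I. ?t A) = - ((\<Sum>A\<in>I. ?t A) * ?t A)" by (rule godd_anticommute[OF o])
    then show ?case using insert by (simp add: algebra_simps sq)
  qed simp
  from this[of UNIV] show ?thesis by (simp flip: gmonom_expansion)
qed

section \<open>Skew derivations and parity\<close>

lemma coeff_skew_deriv_nonzero:
  assumes "coeff (skew_deriv j f) A \<noteq> 0"
  shows "coeff f (insert j A) \<noteq> 0" "card (insert j A) = Suc (card A)"
  using assms by (auto simp: coeff_skew_deriv split: if_splits)

lemma geven_skew_deriv: "f \<in> godd \<Longrightarrow> skew_deriv j f \<in> geven"
  and godd_skew_deriv: "f \<in> geven \<Longrightarrow> skew_deriv j f \<in> godd"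
  using coeff_skew_deriv_nonzero[of j f] unfolding gpart_def mem_Collect_eq by (metis even_Suc)+

lemma gmax_power_skew_deriv:
  assumes "f \<in> gmax_power (Suc k)" shows "skew_deriv j f \<in> gmax_power k"
  using assms coeff_skew_deriv_nonzero[of j f] unfolding gmax_power_iff by (metis Suc_le_mono)

lemma skew_deriv_twice [simp]: "skew_deriv j (skew_deriv j f) = 0"
  by (rule grassmann_eqI) (simp add: coeff_skew_deriv)

lemma is_skew_deriv_skew_deriv: "is_skew_deriv j (skew_deriv j)"
  unfolding skew_deriv_def by (rule theI'[OF ex1_skew_deriv])

lemma module_hom_skew_deriv: "module_hom gscale gscale (skew_deriv j)"
  using is_skew_deriv_skew_deriv by (auto simp: is_skew_deriv_def)

lemma skew_deriv_gvar: "skew_deriv j (gvar k) = (if j = k then 1 else 0)"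
  using is_skew_deriv_skew_deriv[of j] unfolding is_skew_deriv_def by blast

lemma skew_deriv_0 [simp]: "skew_deriv j 0 = 0"
  and skew_deriv_add: "skew_deriv j (f + g) = skew_deriv j f + skew_deriv j g"
  and skew_deriv_diff: "skew_deriv j (f - g) = skew_deriv j f - skew_deriv j g"
  and skew_deriv_scale: "skew_deriv j (gscale c f) = gscale c (skew_deriv j f)"
  and skew_deriv_sum: "skew_deriv j (\<Sum>i\<in>I. h i) = (\<Sum>i\<in>I. skew_deriv j (h i))"
proof -
  interpret module_hom gscale gscale "skew_deriv j" by (rule module_hom_skew_deriv)
  show "skew_deriv j 0 = 0" "skew_deriv j (f + g) = skew_deriv j f + skew_deriv j g"
    "skew_deriv j (f - g) = skew_deriv j f - skew_deriv j g"
    "skew_deriv j (gscale c f) = gscale c (skew_deriv j f)"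
    "skew_deriv j (\<Sum>i\<in>I. h i) = (\<Sum>i\<in>I. skew_deriv j (h i))"
    by (simp_all add: zero add diff scale sum)
qed

lemma skew_deriv_1 [simp]: "skew_deriv j 1 = 0"
  by (rule grassmann_eqI) (simp add: coeff_skew_deriv coeff_1)

text \<open>The defining Leibniz rule concerns one degree at a time. Expanding \<open>a\<close> into
  monomials extends it to mixed degrees with a common sign \<open>c\<close>, in particular to even
  and to odd \<open>a\<close>.\<close>

lemma skew_deriv_mult_parity:
  fixes a b :: "('k::comm_ring_1, 'n::{finite,linorder}) grassmann"
  assumes "\<And>A. coeff a A \<noteq> 0 \<Longrightarrow> (-1) ^ card A = (c :: ('k, 'n) grassmann)"
  shows "skew_deriv j (a * b) = skew_deriv j a * b + c * a * skew_deriv j b"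
proof -
  let ?t = "\<lambda>A. gscale (coeff a A) (gmonom A) :: ('k, 'n) grassmann"
  have t: "skew_deriv j (?t A * b) = skew_deriv j (?t A) * b + c * ?t A * skew_deriv j b" for A
  proof (cases "coeff a A = 0")
    case True
    then have "?t A = 0" by (auto intro: grassmann_eqI)
    then show ?thesis by simp
  next
    case False
    have "?t A \<in> ghomog (card A)" by (auto simp: gpart_def coeff_gmonom)
    then have "skew_deriv j (?t A * b) = skew_deriv j (?t A) * b + (-1) ^ card A * ?t A * skew_deriv j b"
      using is_skew_deriv_skew_deriv[of j] unfolding is_skew_deriv_def by blast
    then show ?thesis using assms[OF False] by simp
  qed
  have "skew_deriv j (a * b) = (\<Sum>A\<in>UNIV. skew_deriv j (?t A * b))"
    by (subst gmonom_expansion[of a]) (simp only: sum_distrib_right skew_deriv_sum)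
  also have "\<dots> = skew_deriv j (\<Sum>A\<in>UNIV. ?t A) * b + c * (\<Sum>A\<in>UNIV. ?t A) * skew_deriv j b"
    by (simp add: t sum.distrib skew_deriv_sum sum_distrib_left sum_distrib_right mult.assoc)
  finally show ?thesis by (simp flip: gmonom_expansion)
qed

lemma skew_deriv_mult_geven:
  "a \<in> geven \<Longrightarrow> skew_deriv j (a * b) = skew_deriv j a * b + a * skew_deriv j b"
  using skew_deriv_mult_parity[of a 1] by (auto simp: gpart_def)

lemma skew_deriv_mult_godd:
  "a \<in> godd \<Longrightarrow> skew_deriv j (a * b) = skew_deriv j a * b - a * skew_deriv j b"
  using skew_deriv_mult_parity[of a "-1"] by (auto simp: gpart_def)

section \<open>Determinants of matrices with even entries\<close>

text \<open>
  The even part as a type of its own: it is a commutative ring, which makes the library's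
  determinants available.
\<close>

typedef (overloaded) ('k::comm_ring_1, 'n) even_part = "geven :: ('k, 'n) grassmann set"
  using gpart_0 by blast

setup_lifting type_definition_even_part

instantiation even_part :: (comm_ring_1, "{finite,linorder}") comm_ring_1
begin
lift_definition zero_even_part :: "('a, 'b) even_part" is 0 by simp
lift_definition one_even_part :: "('a, 'b) even_part" is 1 by simp
lift_definition plus_even_part :: "('a, 'b) even_part \<Rightarrow> ('a, 'b) even_part \<Rightarrow> ('a, 'b) even_part"
  is "(+)" by (rule gpart_add)
lift_definition minus_even_part :: "('a, 'b) even_part \<Rightarrow> ('a, 'b) even_part \<Rightarrow> ('a, 'b) even_part"
  is "(-)" by (rule gpart_diff)
lift_definition uminus_even_part :: "('a, 'b) even_part \<Rightarrow> ('a, 'b) even_part"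
  is uminus by (rule gpart_uminus)
lift_definition times_even_part :: "('a, 'b) even_part \<Rightarrow> ('a, 'b) even_part \<Rightarrow> ('a, 'b) even_part"
  is "(*)" by (rule geven_mult)
instance
  by standard (transfer; simp add: algebra_simps geven_commute)+
end

lemma Rep_even_part_sum: "Rep_even_part (\<Sum>i\<in>I. f i) = (\<Sum>i\<in>I. Rep_even_part (f i))"
  by (induction I rule: infinite_finite_induct)
    (simp_all add: zero_even_part.rep_eq plus_even_part.rep_eq)

lemma Rep_even_part_of_int: "Rep_even_part (of_int k) = of_int k"
proof -
  have n: "Rep_even_part (of_nat m) = of_nat m" for m
    by (induction m) (simp_all add: zero_even_part.rep_eq plus_even_part.rep_eq one_even_part.rep_eq)
  show ?thesis
    by (cases k) (simp_all add: n uminus_even_part.rep_eq minus_even_part.rep_eq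
        one_even_part.rep_eq del: of_nat_Suc)
qed

lemma Rep_even_part_prod_list: "Rep_even_part (prod_list xs) = prod_list (map Rep_even_part xs)"
  by (induction xs) (simp_all add: one_even_part.rep_eq times_even_part.rep_eq)

text \<open>The ordered product is the one in \<open>jac\<close>, so Jacobians are instances by
  unfolding. For even entries the order is immaterial and \<open>gdet_eq_det\<close> leads to
  \<open>det\<close>.\<close>

definition gdet :: "('n \<Rightarrow> 'n \<Rightarrow> ('k::comm_ring_1, 'n::{finite,linorder}) grassmann) \<Rightarrow> ('k, 'n) grassmann"
  where "gdet M = (\<Sum>p | p permutes UNIV. of_int (sign p) *
    prod_list (map (\<lambda>i. M i (p i)) (sorted_list_of_set UNIV)))"

lemma jac_eq_gdet: "jac \<sigma> = gdet (\<lambda>i j. skew_deriv j (\<sigma> (gvar i)))"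
  by (simp add: jac_def gdet_def)

lemma gdet_eq_det:
  fixes M :: "'n \<Rightarrow> 'n \<Rightarrow> ('k::comm_ring_1, 'n::{finite,linorder}) grassmann"
  assumes "\<And>i j. M i j \<in> geven"
  shows "gdet M = Rep_even_part (det (\<chi> i j. Abs_even_part (M i j)))"
proof -
  have "prod (\<lambda>i. Abs_even_part (M i (p i))) UNIV
      = prod_list (map (\<lambda>i. Abs_even_part (M i (p i))) (sorted_list_of_set UNIV))" for p
    using prod.distinct_set_conv_list[of "sorted_list_of_set (UNIV :: 'n set)"] by simp
  then show ?thesis
    by (simp add: gdet_def det_def Rep_even_part_sum times_even_part.rep_eq Rep_even_part_of_int
        Rep_even_part_prod_list o_def Abs_even_part_inverse assms)
qed

lemma gdet_mult:
  assumes "\<And>i j. M i j \<in> geven" "\<And>i j. N i j \<in> geven"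
  shows "gdet (\<lambda>i j. \<Sum>k\<in>UNIV. M i k * N k j) = gdet M * gdet N"
proof -
  have "(\<chi> i j. Abs_even_part (\<Sum>k\<in>UNIV. M i k * N k j))
      = (\<chi> i j. Abs_even_part (M i j)) ** (\<chi> i j. Abs_even_part (N i j))"
    by (simp add: matrix_matrix_mult_def vec_eq_iff Rep_even_part_inject[symmetric] Rep_even_part_sum
        times_even_part.rep_eq Abs_even_part_inverse assms gpart_sum geven_mult)
  then show ?thesis
    by (simp add: gdet_eq_det assms gpart_sum geven_mult det_mul times_even_part.rep_eq)
qed

lemma geven_gdet: "(\<And>i j. M i j \<in> geven) \<Longrightarrow> gdet M \<in> geven"
  unfolding gdet_def by (intro gpart_sum geven_mult geven_of_int geven_prod_list) auto

text \<open>Apart from a multiple of the earlier error, the next factor \<open>1 + c i\<close> adds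
  to the error only \<open>c i\<close> times the previous sum, which has order
  \<open>2 * k\<close>.\<close>

lemma prod_list_one_plus:
  assumes "\<And>i. c i \<in> gmax_power k" "distinct xs"
  shows "prod_list (map (\<lambda>i. 1 + c i) xs) - (1 + (\<Sum>i\<in>set xs. c i)) \<in> gmax_power (2 * k)"
  using assms(2)
proof (induction xs)
  case (Cons i xs)
  let ?p = "prod_list (map (\<lambda>i. 1 + c i) xs)" and ?s = "\<Sum>i\<in>set xs. c i"
  have "?s \<in> gmax_power k" by (intro gmax_power_sum assms)
  then have "c i * ?s \<in> gmax_power (2 * k)" using gmax_power_mult[OF assms(1)] by (simp add: mult_2)
  then have "(1 + c i) * (?p - (1 + ?s)) + c i * ?s \<in> gmax_power (2 * k)"
    using Cons by (intro gmax_power_add gmax_power_multR[of "?p - (1 + ?s)"]) auto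
  moreover have "prod_list (map (\<lambda>i. 1 + c i) (i # xs)) - (1 + (\<Sum>i\<in>set (i # xs). c i))
      = (1 + c i) * (?p - (1 + ?s)) + c i * ?s"
    using Cons.prems by (simp add: algebra_simps)
  ultimately show ?case by simp
qed simp

lemma prod_list_gmax_power:
  assumes "distinct xs" "\<And>i. i \<in> T \<Longrightarrow> f i \<in> gmax_power k"
  shows "prod_list (map f xs) \<in> gmax_power (card (set xs \<inter> T) * k)"
  using assms(1)
proof (induction xs)
  case (Cons i xs)
  show ?case
  proof (cases "i \<in> T")
    case True
    then have "f i * prod_list (map f xs) \<in> gmax_power (k + card (set xs \<inter> T) * k)"
      using Cons by (intro gmax_power_mult assms) auto
    moreover have "card (set (i # xs) \<inter> T) = Suc (card (set xs \<inter> T))"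
      using True Cons.prems by simp
    ultimately show ?thesis by simp
  qed (use Cons in \<open>auto intro: gmax_power_multR\<close>)
qed simp

text \<open>A permutation other than the identity moves some index and also its image, hence has at
  least two off-diagonal factors, each of order \<open>k\<close>. The identity permutation
  contributes \<open>1\<close> plus the trace, up to order \<open>2 * k\<close>.\<close>

lemma gdet_one_plus:
  fixes C :: "'n \<Rightarrow> 'n \<Rightarrow> ('k::comm_ring_1, 'n::{finite,linorder}) grassmann"
  assumes "\<And>i j. C i j \<in> gmax_power k"
  shows "gdet (\<lambda>i j. (if i = j then 1 else 0) + C i j) - (1 + (\<Sum>i\<in>UNIV. C i i)) \<in> gmax_power (2 * k)"
proof -
  let ?M = "\<lambda>i j. (if i = j then 1 else 0) + C i j"
  let ?t = "\<lambda>p. of_int (sign p) * prod_list (map (\<lambda>i. ?M i (p i)) (sorted_list_of_set UNIV))"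
  have off: "?t p \<in> gmax_power (2 * k)" if p: "p permutes UNIV" "p \<noteq> id" for p
  proof -
    let ?T = "{i. p i \<noteq> i}"
    obtain i where i: "p i \<noteq> i" using p(2) by (metis eq_id_iff)
    then have "p (p i) \<noteq> p i" using p(1) by (metis permutes_def)
    then have "{i, p i} \<subseteq> ?T" using i by auto
    then have "card {i, p i} \<le> card ?T" by (intro card_mono) auto
    then have "2 \<le> card ?T" using i by (simp add: card_insert_if)
    then have "2 * k \<le> card (set (sorted_list_of_set UNIV) \<inter> ?T) * k" by simp
    moreover have "prod_list (map (\<lambda>i. ?M i (p i)) (sorted_list_of_set UNIV))
        \<in> gmax_power (card (set (sorted_list_of_set UNIV) \<inter> ?T) * k)"
      by (rule prod_list_gmax_power) (use assms in auto)
    ultimately show ?thesis by (intro gmax_power_multR) (rule gmax_power_mono)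
  qed
  have "gdet ?M = ?t id + (\<Sum>p\<in>{p. p permutes UNIV} - {id}. ?t p)"
    unfolding gdet_def by (subst sum.remove[of _ id]) (auto simp: permutes_id)
  moreover have "?t id - (1 + (\<Sum>i\<in>UNIV. C i i)) \<in> gmax_power (2 * k)"
    using prod_list_one_plus[of "\<lambda>i. C i i" k "sorted_list_of_set UNIV"] assms by (simp add: sign_id)
  moreover have "(\<Sum>p\<in>{p. p permutes UNIV} - {id}. ?t p) \<in> gmax_power (2 * k)"
    by (intro gmax_power_sum off) auto
  ultimately show ?thesis
    using gmax_power_add[of "?t id - (1 + (\<Sum>i\<in>UNIV. C i i))" "2 * k" "\<Sum>p\<in>{p. p permutes UNIV} - {id}. ?t p"]
    by (simp only: add_diff_eq diff_add_eq)
qed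

text \<open>A permutation other than the identity moves at least two indices, hence one different
  from \<open>r\<close>, where the off-diagonal entry is \<open>0\<close>.\<close>

lemma gdet_single_row:
  fixes M :: "'n \<Rightarrow> 'n \<Rightarrow> ('k::comm_ring_1, 'n::{finite,linorder}) grassmann"
  assumes "\<And>i j. i \<noteq> r \<Longrightarrow> M i j = (if i = j then 1 else 0)"
  shows "gdet M = M r r"
proof -
  let ?t = "\<lambda>p. of_int (sign p) * prod_list (map (\<lambda>i. M i (p i)) (sorted_list_of_set UNIV))"
  have 0: "?t p = 0" if p: "p permutes UNIV" "p \<noteq> id" for p
  proof -
    obtain i where i: "p i \<noteq> i" using p(2) by (metis eq_id_iff)
    then have "p (p i) \<noteq> p i" using p(1) by (metis permutes_def)
    then obtain l where "l \<noteq> r" "p l \<noteq> l" using i by metis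
    then have "M l (p l) = 0" by (simp add: assms)
    then have "prod_list (map (\<lambda>i. M i (p i)) xs) = 0" if "l \<in> set xs" for xs
      using that by (induction xs) auto
    then show ?thesis by simp
  qed
  have "gdet M = ?t id + (\<Sum>p\<in>{p. p permutes UNIV} - {id}. ?t p)"
    unfolding gdet_def by (subst sum.remove[of _ id]) (auto simp: permutes_id)
  also have "(\<Sum>p\<in>{p. p permutes UNIV} - {id}. ?t p) = 0"
    by (intro sum.neutral ballI 0) auto
  also have "prod_list (map (\<lambda>i. M i i) xs) = (if r \<in> set xs then M r r else 1)" if "distinct xs" for xs
    using that
  proof (induction xs)
    case (Cons i xs)
    then show ?case by (cases "i = r") (auto simp: assms)
  qed simp
  then have "?t id = M r r" by (simp add: sign_id)
  finally show ?thesis by simp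
qed

section \<open>Generation by automorphisms moving one generator\<close>

declare gmax_power.simps(2) [simp del]

text \<open>Successive approximation: \<open>F\<close> is the identity to leading order, so
  \<open>g\<close> is a first guess for its own preimage and the error \<open>g - F g\<close> has
  higher order. The set \<open>D\<close> carries parity along.\<close>

lemma filtered_surj:
  fixes F :: "('k::comm_ring_1, 'n::{finite,linorder}) grassmann \<Rightarrow> ('k, 'n) grassmann"
  assumes add: "\<And>f g. F (f + g) = F f + F g"
    and raise: "\<And>k f. f \<in> gmax_power k \<Longrightarrow> F f - f \<in> gmax_power (Suc k)"
    and D: "\<And>f. f \<in> gpart D \<Longrightarrow> F f \<in> gpart D"
    and g: "g \<in> gpart D" "g \<in> gmax_power k"
  shows "\<exists>f \<in> gpart D \<inter> gmax_power k. F f = g"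
  using g
\<comment> \<open>The measure is \<open>0\<close> only for \<open>k\<close> beyond the top degree,
  where \<open>g\<close> vanishes.\<close>
proof (induction "Suc CARD('n) - k" arbitrary: k g)
  case 0
  then have "g = 0" by (intro gmax_power_trivial) auto
  moreover have "F 0 = 0" using add[of 0 0] by simp
  ultimately show ?case by (intro bexI[of _ 0]) auto
next
  case (Suc m)
  have "g - F g \<in> gmax_power (Suc k)" "g - F g \<in> gpart D"
    using raise D Suc.prems by (auto intro: gmax_power_diff_commute gpart_diff)
  moreover have "m = Suc CARD('n) - Suc k" using Suc.hyps(2) by arith
  ultimately obtain f where f: "f \<in> gpart D" "f \<in> gmax_power (Suc k)" "F f = g - F g"
    using Suc.hyps(1)[of "Suc k" "g - F g"] by auto
  then have "g + f \<in> gpart D \<inter> gmax_power k" "F (g + f) = g"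
    using Suc.prems gmax_power_mono[of f "Suc k" k] by (auto simp: add intro: gpart_add gmax_power_add)
  then show ?case by blast
qed

lemma filtered_bij:
  fixes F :: "('k::comm_ring_1, 'n::{finite,linorder}) grassmann \<Rightarrow> ('k, 'n) grassmann"
  assumes add: "\<And>f g. F (f + g) = F f + F g"
    and raise: "\<And>k f. f \<in> gmax_power k \<Longrightarrow> F f - f \<in> gmax_power (Suc k)"
  shows "bij F"
proof (rule bijI)
  show "surj F"
    unfolding surj_def
  proof
    fix g :: "('k, 'n) grassmann"
    have "g \<in> gpart UNIV" "g \<in> gmax_power 0" by (auto simp: gpart_def)
    from filtered_surj[where F = F and D = UNIV, OF add raise _ this]
    show "\<exists>f. g = F f" by (auto simp: gpart_def)
  qed
  show "inj F"
  proof (rule injI)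
    fix f g assume eq: "F f = F g"
    have "F f = F (f - g) + F g" using add[of "f - g" g] by simp
    then have "F (f - g) = 0" using eq by simp
    \<comment> \<open>For \<open>h\<close> in the kernel, \<open>F h - h\<close> is
      \<open>- h\<close>, so \<open>raise\<close> pushes \<open>h\<close> into ever deeper
      powers.\<close>
    have "f - g \<in> gmax_power k" for k
    proof (induction k)
      case (Suc k)
      from raise[OF this] gmax_power_uminus show ?case unfolding \<open>F (f - g) = 0\<close> by fastforce
    qed simp
    then have "f - g = 0" by (intro gmax_power_trivial) auto
    then show "f = g" by simp
  qed
qed

text \<open>The conditions of \<open>Gam\<close> on generators are replaced by conditions on all
  elements, which are stable under composition and inversion. \<open>Gam_eq_graut\<close> shows that
  the set is the same.\<close>

definition graut :: "(('k::comm_ring_1, 'n::{finite,linorder}) grassmann \<Rightarrow> ('k, 'n) grassmann) set"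
  where "graut = {\<sigma>. is_alg_aut \<sigma> \<and> (\<forall>f\<in>geven. \<sigma> f \<in> geven) \<and> (\<forall>f\<in>godd. \<sigma> f \<in> godd)
    \<and> (\<forall>k. \<forall>f\<in>gmax_power k. \<sigma> f - f \<in> gmax_power (k + 2))}"

lemma alg_aut_mult: "is_alg_aut \<sigma> \<Longrightarrow> \<sigma> (f * g) = \<sigma> f * \<sigma> g"
  and alg_aut_1: "is_alg_aut \<sigma> \<Longrightarrow> \<sigma> 1 = 1"
  and alg_aut_bij: "is_alg_aut \<sigma> \<Longrightarrow> bij \<sigma>"
  and alg_aut_module_hom: "is_alg_aut \<sigma> \<Longrightarrow> module_hom gscale gscale \<sigma>"
  by (auto simp: is_alg_aut_def)

lemma alg_aut_add: "is_alg_aut \<sigma> \<Longrightarrow> \<sigma> (f + g) = \<sigma> f + \<sigma> g"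
  and alg_aut_diff: "is_alg_aut \<sigma> \<Longrightarrow> \<sigma> (f - g) = \<sigma> f - \<sigma> g"
  and alg_aut_0: "is_alg_aut \<sigma> \<Longrightarrow> \<sigma> 0 = 0"
  and alg_aut_sum: "is_alg_aut \<sigma> \<Longrightarrow> \<sigma> (\<Sum>i\<in>I. h i) = (\<Sum>i\<in>I. \<sigma> (h i))"
  and alg_aut_scale: "is_alg_aut \<sigma> \<Longrightarrow> \<sigma> (gscale c f) = gscale c (\<sigma> f)"
  using module_hom.add[of gscale gscale \<sigma>] module_hom.diff[of gscale gscale \<sigma>]
    module_hom.zero[of gscale gscale \<sigma>] module_hom.sum[of gscale gscale \<sigma>]
    module_hom.scale[of gscale gscale \<sigma>] alg_aut_module_hom by blast+

lemma alg_aut_of_int: "is_alg_aut \<sigma> \<Longrightarrow> \<sigma> (of_int k) = of_int k"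
proof -
  assume \<sigma>: "is_alg_aut \<sigma>"
  have n: "\<sigma> (of_nat m) = of_nat m" for m
    by (induction m) (simp_all add: \<sigma> alg_aut_0 alg_aut_1 alg_aut_add)
  show ?thesis
    by (cases k) (simp_all add: n \<sigma> alg_aut_1 alg_aut_diff alg_aut_0 alg_aut_diff[of \<sigma> 0, simplified]
        del: of_nat_Suc)
qed

lemma alg_aut_prod_list: "is_alg_aut \<sigma> \<Longrightarrow> \<sigma> (prod_list xs) = prod_list (map \<sigma> xs)"
  by (induction xs) (simp_all add: alg_aut_1 alg_aut_mult)

lemma alg_aut_id: "is_alg_aut id"
  by (auto simp: is_alg_aut_def module_hom_def module_hom_axioms_def module_gscale)

lemma alg_aut_comp: "is_alg_aut \<sigma> \<Longrightarrow> is_alg_aut \<tau> \<Longrightarrow> is_alg_aut (\<sigma> \<circ> \<tau>)"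
  unfolding is_alg_aut_def by (auto intro: bij_comp module_hom_compose)

lemma alg_aut_inv_apply:
  assumes "is_alg_aut \<sigma>" shows "inv \<sigma> (\<sigma> f) = f" "\<sigma> (inv \<sigma> f) = f"
  using alg_aut_bij[OF assms] by (auto simp: bij_is_inj bij_is_surj surj_f_inv_f)

lemma alg_aut_inv:
  assumes "is_alg_aut \<sigma>" shows "is_alg_aut (inv \<sigma>)"
proof -
  note s = alg_aut_inv_apply[OF assms]
  have i: "inv \<sigma> g = f" if "\<sigma> f = g" for f g using that s by metis
  show ?thesis
    unfolding is_alg_aut_def module_hom_def module_hom_axioms_def
    using alg_aut_bij[OF assms]
    by (auto intro!: i module_gscale bij_imp_bij_inv
        simp: alg_aut_add[OF assms] alg_aut_mult[OF assms] alg_aut_scale[OF assms] alg_aut_1[OF assms] s)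
qed

lemma graut_alg_aut: "\<sigma> \<in> graut \<Longrightarrow> is_alg_aut \<sigma>"
  and graut_geven: "\<sigma> \<in> graut \<Longrightarrow> f \<in> geven \<Longrightarrow> \<sigma> f \<in> geven"
  and graut_godd: "\<sigma> \<in> graut \<Longrightarrow> f \<in> godd \<Longrightarrow> \<sigma> f \<in> godd"
  and graut_raise: "\<sigma> \<in> graut \<Longrightarrow> f \<in> gmax_power k \<Longrightarrow> \<sigma> f - f \<in> gmax_power (k + 2)"
  unfolding graut_def by blast+

lemma graut_gmax_power: "\<sigma> \<in> graut \<Longrightarrow> f \<in> gmax_power k \<Longrightarrow> \<sigma> f \<in> gmax_power k"
  using gmax_power_add[of "\<sigma> f - f" k f] gmax_power_mono[OF graut_raise, of \<sigma> f k k] by simp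

lemma graut_id: "id \<in> graut"
  by (simp add: graut_def alg_aut_id)

lemma graut_comp:
  assumes "\<sigma> \<in> graut" "\<tau> \<in> graut" shows "\<sigma> \<circ> \<tau> \<in> graut"
proof -
  have "\<sigma> (\<tau> f) - f \<in> gmax_power (k + 2)" if "f \<in> gmax_power k" for f k
    using gmax_power_add[OF graut_raise[OF assms(1) graut_gmax_power[OF assms(2) that]]
        graut_raise[OF assms(2) that]] by simp
  then show ?thesis using assms by (simp add: graut_def alg_aut_comp)
qed

text \<open>\<open>filtered_surj\<close> yields preimages of the same parity and order; by
  injectivity these are the values of the inverse.\<close>

lemma graut_inv:
  assumes "\<sigma> \<in> graut" shows "inv \<sigma> \<in> graut"
proof -
  note a = graut_alg_aut[OF assms]
  have r: "\<sigma> f - f \<in> gmax_power (Suc k)" if "f \<in> gmax_power k" for f k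
    using gmax_power_mono[OF graut_raise[OF assms that]] by simp
  have s: "inv \<sigma> g \<in> gpart D \<inter> gmax_power k"
    if D: "\<And>f. f \<in> gpart D \<Longrightarrow> \<sigma> f \<in> gpart D" and g: "g \<in> gpart D" "g \<in> gmax_power k" for g D k
  proof -
    obtain f where "f \<in> gpart D \<inter> gmax_power k" "\<sigma> f = g"
      using filtered_surj[OF alg_aut_add[OF a] r D g] by blast
    then show ?thesis using alg_aut_inv_apply(1)[OF a, of f] by metis
  qed
  have m: "inv \<sigma> g \<in> gmax_power k" if "g \<in> gmax_power k" for g k
    using s[of UNIV] that by (auto simp: gpart_def)
  have "inv \<sigma> g - g \<in> gmax_power (k + 2)" if "g \<in> gmax_power k" for g k
    using graut_raise[OF assms m[OF that]]
    by (simp add: alg_aut_inv_apply[OF a] gmax_power_diff_commute)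
  moreover have "inv \<sigma> f \<in> geven" if "f \<in> geven" for f
    using s[of "{d. even d}" f 0] graut_geven[OF assms] that by simp
  moreover have "inv \<sigma> f \<in> godd" if "f \<in> godd" for f
    using s[of "{d. odd d}" f 0] graut_godd[OF assms] that by simp
  ultimately show ?thesis by (simp add: graut_def alg_aut_inv[OF a])
qed

section \<open>Transvections\<close>

text \<open>Every \<open>f\<close> is affine in \<open>x_r\<close>: it is
  \<open>g + x_r * skew_deriv r f\<close> with \<open>g\<close> free of \<open>x_r\<close>.
  Substituting \<open>x_r + b\<close> for \<open>x_r\<close> gives this formula.\<close>

definition transvection ::
    "'n::{finite,linorder} \<Rightarrow> ('k::comm_ring_1, 'n) grassmann \<Rightarrow> ('k, 'n) grassmann \<Rightarrow> ('k, 'n) grassmann"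
  where "transvection r b f = f + b * skew_deriv r f"

lemma transvection_gvar: "transvection r b (gvar i) = (if i = r then gvar i + b else gvar i)"
  by (simp add: transvection_def skew_deriv_gvar)

text \<open>By additivity \<open>f\<close> may be taken even or odd. Moving \<open>b\<close> past
  \<open>f\<close> produces the sign of the Leibniz rule, and the term with both derivatives
  contains \<open>b * b\<close>, which is \<open>0\<close> for odd \<open>b\<close>.\<close>

lemma transvection_mult:
  assumes b: "b \<in> godd"
  shows "transvection r b (f * g) = transvection r b f * transvection r b g"
proof -
  have even: "transvection r b (f * g) = transvection r b f * transvection r b g" if f: "f \<in> geven" for f g
  proof -
    let ?f = "skew_deriv r f" and ?g = "skew_deriv r g"
    have "b * ?f * (b * ?g) = - (b * b * ?f * ?g)"
      using godd_anticommute[OF b godd_skew_deriv[OF f]] by (simp add: mult.assoc) (simp flip: mult.assoc)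
    moreover have "f * (b * ?g) = b * f * ?g"
      using geven_commute[OF f, of b] by (simp flip: mult.assoc)
    ultimately show ?thesis
      by (simp add: transvection_def skew_deriv_mult_geven[OF f] distrib_left distrib_right
          godd_square[OF b] mult.assoc)
  qed
  have odd: "transvection r b (f * g) = transvection r b f * transvection r b g" if f: "f \<in> godd" for f g
  proof -
    let ?f = "skew_deriv r f" and ?g = "skew_deriv r g"
    have "b * ?f * (b * ?g) = b * b * ?f * ?g"
      using geven_commute[OF geven_skew_deriv[OF f], of r b] by (simp add: mult.assoc) (simp flip: mult.assoc)
    moreover have "f * (b * ?g) = - (b * f * ?g)"
      using godd_anticommute[OF f b] by (simp flip: mult.assoc)
    ultimately show ?thesis
      by (simp add: transvection_def skew_deriv_mult_godd[OF f] distrib_left distrib_right right_diff_distrib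
          godd_square[OF b] mult.assoc)
  qed
  obtain f0 f1 where f: "f0 \<in> geven" "f1 \<in> godd" "f = f0 + f1" by (rule parity_decomposition)
  have add: "transvection r b (u + v) = transvection r b u + transvection r b v" for u v
    by (simp add: transvection_def skew_deriv_add algebra_simps)
  show ?thesis unfolding f(3) by (simp add: distrib_right add even[OF f(1)] odd[OF f(2)])
qed

lemma transvection_graut:
  assumes "b \<in> godd" "b \<in> gmax_power 3"
  shows "transvection r b \<in> graut"
proof -
  have add: "transvection r b (u + v) = transvection r b u + transvection r b v" for u v
    by (simp add: transvection_def skew_deriv_add algebra_simps)
  have raise: "transvection r b f - f \<in> gmax_power (k + 2)" if "f \<in> gmax_power k" for f k
  \<comment> \<open>For positive \<open>k\<close> the derivative loses one degree and
    \<open>b\<close> gains three. For \<open>k = 0\<close> there is no degree to lose, and the order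
    of \<open>b\<close> alone suffices.\<close>
  proof (cases k)
    case 0
    then show ?thesis using gmax_power_mono[OF gmax_power_multL[OF assms(2)], of 2 "skew_deriv r f"]
      by (simp add: transvection_def numeral_2_eq_2)
  next
    case (Suc l)
    then have "skew_deriv r f \<in> gmax_power l" using that gmax_power_skew_deriv by blast
    from gmax_power_mult[OF assms(2) this] show ?thesis
      by (simp add: transvection_def Suc numeral_3_eq_3)
  qed
  have "bij (transvection r b)"
    by (rule filtered_bij[OF add gmax_power_mono[OF raise]]) auto
  moreover have "transvection r b (gscale c f) = gscale c (transvection r b f)" for c f
    by (rule grassmann_eqI) (simp add: transvection_def skew_deriv_scale gscale_mult distrib_left)
  moreover have "transvection r b 1 = 1" by (simp add: transvection_def)
  moreover have "transvection r b f \<in> geven" if "f \<in> geven" for f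
    using that assms unfolding transvection_def by (intro gpart_add godd_mult godd_skew_deriv)
  moreover have "transvection r b f \<in> godd" if "f \<in> godd" for f
    using that assms unfolding transvection_def by (intro gpart_add godd_geven_mult geven_skew_deriv)
  ultimately show ?thesis
    using raise
    by (simp add: graut_def is_alg_aut_def module_hom_def module_hom_axioms_def module_gscale
        transvection_mult[OF assms(1)] add)
qed

text \<open>New factors stand on the right and act first, so among the generators only the value at
  \<open>x_r\<close> changes, by \<sigma>(b). Products without inverses exhaust \<open>Gam\<close>
  by \<open>Gam_subset_transvection_monoid\<close>.\<close>

inductive_set transvection_monoid :: "(('k::comm_ring_1, 'n::{finite,linorder}) grassmann \<Rightarrow> ('k, 'n) grassmann) set"
  where id: "id \<in> transvection_monoid"
  | comp: "\<sigma> \<in> transvection_monoid \<Longrightarrow> b \<in> godd \<Longrightarrow> b \<in> gmax_power 3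
      \<Longrightarrow> \<sigma> \<circ> transvection r b \<in> transvection_monoid"

lemma transvection_monoid_graut: "\<sigma> \<in> transvection_monoid \<Longrightarrow> \<sigma> \<in> graut"
  by (induction rule: transvection_monoid.induct) (rule graut_id, intro graut_comp transvection_graut)

text \<open>The coordinates are adjusted one at a time; each step solves \<open>\<sigma>(x\<^sub>r + b) = y\<^sub>r\<close> for \<open>b\<close>.\<close>

lemma transvection_monoid_values:
  assumes y: "\<And>i. y i - gvar i \<in> godd \<inter> gmax_power 3"
  shows "\<exists>\<sigma>\<in>transvection_monoid. \<forall>i. \<sigma> (gvar i) = y i"
proof -
  have "\<exists>\<sigma>\<in>transvection_monoid. \<forall>i. \<sigma> (gvar i) = (if i \<in> S then y i else gvar i)" if "finite S" for S
    using that
  proof induction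
    case empty
    show ?case using transvection_monoid.id by (intro bexI[of _ id]) auto
  next
    case (insert r S)
    then obtain \<sigma> where \<sigma>: "\<sigma> \<in> transvection_monoid" "\<And>i. \<sigma> (gvar i) = (if i \<in> S then y i else gvar i)" by blast
    note g = transvection_monoid_graut[OF \<sigma>(1)]
    define b where "b = inv \<sigma> (y r - gvar r)"
    have "b \<in> godd" "b \<in> gmax_power 3"
      using y[of r] graut_godd[OF graut_inv[OF g]] graut_gmax_power[OF graut_inv[OF g]]
      unfolding b_def by blast+
    with \<sigma>(1) have "\<sigma> \<circ> transvection r b \<in> transvection_monoid" by (rule transvection_monoid.comp)
    moreover have "\<sigma> b = y r - gvar r"
      unfolding b_def by (rule alg_aut_inv_apply[OF graut_alg_aut[OF g]])
    then have "(\<sigma> \<circ> transvection r b) (gvar i) = (if i \<in> insert r S then y i else gvar i)" for i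
      using insert.hyps(2) by (simp add: transvection_gvar \<sigma>(2) alg_aut_add[OF graut_alg_aut[OF g]])
    ultimately show ?case by blast
  qed
  from this[of UNIV] show ?thesis by simp
qed

lemma graut_subset_Gam: "\<sigma> \<in> graut \<Longrightarrow> \<sigma> \<in> Gam"
  using graut_raise[OF _ gmax_power_gvar, of \<sigma>]
  by (auto simp: Gam_def graut_alg_aut graut_godd numeral_3_eq_3 intro!: gpart_diff)

lemma Gam_subset_transvection_monoid:
  assumes "\<sigma> \<in> Gam" shows "\<sigma> \<in> transvection_monoid"
proof -
  obtain \<tau> where \<tau>: "\<tau> \<in> transvection_monoid" "\<And>i. \<tau> (gvar i) = \<sigma> (gvar i)"
    using transvection_monoid_values[of "\<lambda>i. \<sigma> (gvar i)"] assms unfolding Gam_def by blast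
  have "\<tau> = \<sigma>"
    by (rule alg_aut_eqI) (use \<tau> assms graut_alg_aut[OF transvection_monoid_graut] in \<open>auto simp: Gam_def\<close>)
  then show ?thesis using \<tau>(1) by simp
qed

lemma Gam_eq_graut: "Gam = graut"
  using graut_subset_Gam Gam_subset_transvection_monoid transvection_monoid_graut by blast

text \<open>Supplies the automorphism that the definition of \<open>phi'\<close> selects by its
  values.\<close>

lemma Gam_values:
  assumes "\<And>i. y i - gvar i \<in> godd \<inter> gmax_power 3"
  obtains \<sigma> where "\<sigma> \<in> Gam" "\<And>i. \<sigma> (gvar i) = y i"
  using transvection_monoid_values[OF assms] transvection_monoid_graut graut_subset_Gam by blast

section \<open>The Jacobian\<close>

lemma Gam_alg_aut: "\<sigma> \<in> Gam \<Longrightarrow> is_alg_aut \<sigma>"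
  and Gam_geven: "\<sigma> \<in> Gam \<Longrightarrow> f \<in> geven \<Longrightarrow> \<sigma> f \<in> geven"
  and Gam_godd: "\<sigma> \<in> Gam \<Longrightarrow> f \<in> godd \<Longrightarrow> \<sigma> f \<in> godd"
  and Gam_gmax_power: "\<sigma> \<in> Gam \<Longrightarrow> f \<in> gmax_power k \<Longrightarrow> \<sigma> f \<in> gmax_power k"
  and Gam_comp: "\<sigma> \<in> Gam \<Longrightarrow> \<tau> \<in> Gam \<Longrightarrow> \<sigma> \<circ> \<tau> \<in> Gam"
  and Gam_inv: "\<sigma> \<in> Gam \<Longrightarrow> inv \<sigma> \<in> Gam"
  and Gam_id: "id \<in> Gam"
  unfolding Gam_eq_graut
  by (fact graut_alg_aut graut_geven graut_godd graut_gmax_power graut_comp graut_inv graut_id)+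

lemma Gam_bij: "\<sigma> \<in> Gam \<Longrightarrow> bij \<sigma>"
  by (simp add: Gam_alg_aut alg_aut_bij)

lemma Gam_inv_comp:
  assumes "\<sigma> \<in> Gam" shows "inv \<sigma> \<circ> \<sigma> = id" "\<sigma> \<circ> inv \<sigma> = id"
  using Gam_bij[OF assms] by (auto simp: bij_is_inj bij_is_surj simp flip: surj_iff)

lemma Gam_jacobian_entry: "\<sigma> \<in> Gam \<Longrightarrow> skew_deriv j (\<sigma> (gvar i)) \<in> geven"
  by (rule geven_skew_deriv, erule Gam_godd, rule godd_gvar)

text \<open>Both sides are linear in \<open>f\<close>, so products of generators suffice. In the
  induction the even Jacobian entries commute with \<sigma>(x_i), and splitting off a generator
  gives the same odd Leibniz sign on both sides.\<close>

lemma skew_deriv_chain: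
  fixes \<sigma> :: "('k::comm_ring_1, 'n::{finite,linorder}) grassmann \<Rightarrow> ('k, 'n) grassmann"
  assumes "\<sigma> \<in> Gam"
  shows "skew_deriv j (\<sigma> f) = (\<Sum>k\<in>UNIV. skew_deriv j (\<sigma> (gvar k)) * \<sigma> (skew_deriv k f))"
proof -
  note a = Gam_alg_aut[OF assms]
  let ?R = "\<lambda>f. \<Sum>k\<in>UNIV. skew_deriv j (\<sigma> (gvar k)) * \<sigma> (skew_deriv k f)"
  have L: "module_hom gscale gscale (\<lambda>f. skew_deriv j (\<sigma> f))"
    by (auto simp: module_hom_def module_hom_axioms_def module_gscale alg_aut_add[OF a] skew_deriv_add
        alg_aut_scale[OF a] skew_deriv_scale)
  have "?R (gscale c f) = gscale c (?R f)" for c f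
    by (rule grassmann_eqI) (simp add: alg_aut_scale[OF a] skew_deriv_scale gscale_mult sum_distrib_left)
  then have R: "module_hom gscale gscale ?R"
    by (auto simp: module_hom_def module_hom_axioms_def module_gscale alg_aut_add[OF a] skew_deriv_add
        distrib_left sum.distrib)
  have "skew_deriv j (\<sigma> (prod_list (map gvar xs))) = ?R (prod_list (map gvar xs))" for xs
  proof (induction xs)
    case (Cons i xs)
    let ?g = "prod_list (map gvar xs)"
    have "skew_deriv j (\<sigma> (gvar k)) * \<sigma> (skew_deriv k (gvar i * ?g))
        = (if k = i then skew_deriv j (\<sigma> (gvar i)) * \<sigma> ?g else 0)
          - \<sigma> (gvar i) * (skew_deriv j (\<sigma> (gvar k)) * \<sigma> (skew_deriv k ?g))" for k
      using geven_commute[OF Gam_jacobian_entry[OF assms, of j k], of "\<sigma> (gvar i)"]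
      by (simp add: skew_deriv_mult_godd skew_deriv_gvar alg_aut_diff[OF a] alg_aut_mult[OF a]
          alg_aut_0[OF a] alg_aut_1[OF a] right_diff_distrib flip: mult.assoc)
    then have "?R (gvar i * ?g) = skew_deriv j (\<sigma> (gvar i)) * \<sigma> ?g - \<sigma> (gvar i) * ?R ?g"
      by (simp add: sum_subtractf sum_distrib_left)
    then show ?case
      by (simp add: alg_aut_mult[OF a] skew_deriv_mult_godd Gam_godd[OF assms] Cons)
  qed (simp add: alg_aut_0[OF a] alg_aut_1[OF a])
  then have "skew_deriv j (\<sigma> (gmonom A)) = ?R (gmonom A)" for A
    unfolding gmonom_def .
  then show ?thesis by (rule linear_eqI[OF L R])
qed

lemma alg_aut_gdet:
  assumes "is_alg_aut \<sigma>" shows "\<sigma> (gdet M) = gdet (\<lambda>i j. \<sigma> (M i j))"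
  by (simp add: gdet_def alg_aut_sum[OF assms] alg_aut_mult[OF assms] alg_aut_of_int[OF assms]
      alg_aut_prod_list[OF assms] o_def)

text \<open>By the chain rule the Jacobian matrix of the composite is the product of the matrix of
  \<tau>, with \<sigma> applied to its entries, and the matrix of \<sigma>. All entries are even, so
  \<open>gdet_mult\<close> applies.\<close>

lemma jac_comp:
  assumes "\<sigma> \<in> Gam" "\<tau> \<in> Gam" shows "jac (\<sigma> \<circ> \<tau>) = \<sigma> (jac \<tau>) * jac \<sigma>"
proof -
  have "jac (\<sigma> \<circ> \<tau>) = gdet (\<lambda>i j. \<Sum>k\<in>UNIV. \<sigma> (skew_deriv k (\<tau> (gvar i))) * skew_deriv j (\<sigma> (gvar k)))"
    by (simp add: jac_eq_gdet skew_deriv_chain[OF assms(1), of _ "\<tau> _"]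
        geven_commute[OF Gam_jacobian_entry[OF assms(1)], of _ _ "\<sigma> _"])
  also have "\<dots> = gdet (\<lambda>i j. \<sigma> (skew_deriv j (\<tau> (gvar i)))) * jac \<sigma>"
    unfolding jac_eq_gdet
    by (rule gdet_mult) (use assms in \<open>auto intro: Gam_geven[OF assms(1)] Gam_jacobian_entry\<close>)
  finally show ?thesis by (simp add: jac_eq_gdet alg_aut_gdet[OF Gam_alg_aut[OF assms(1)]])
qed

lemma geven_jac: "\<sigma> \<in> Gam \<Longrightarrow> jac \<sigma> \<in> geven"
  unfolding jac_eq_gdet by (rule geven_gdet) (rule Gam_jacobian_entry)

text \<open>All rows are unit rows, so the arbitrary index \<open>undefined\<close> can serve as the
  exceptional row.\<close>

lemma jac_id: "jac id = 1"
  unfolding jac_eq_gdet by (subst gdet_single_row[of undefined]) (auto simp: skew_deriv_gvar)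

lemma jac_inv:
  assumes "\<sigma> \<in> Gam" shows "\<sigma> (jac (inv \<sigma>)) * jac \<sigma> = 1"
  using jac_comp[OF assms Gam_inv[OF assms]] by (simp add: Gam_inv_comp[OF assms] jac_id)

text \<open>This is \<open>gdet_one_plus\<close> for the derivatives of the displacements of the
  generators, whose order drops from \<open>Suc k\<close> to \<open>k\<close>.\<close>

lemma jac_first_order:
  fixes \<sigma> :: "('k::comm_ring_1, 'n::{finite,linorder}) grassmann \<Rightarrow> ('k, 'n) grassmann"
  assumes "\<And>i. \<sigma> (gvar i) - gvar i \<in> gmax_power (Suc k)"
  shows "jac \<sigma> - (1 + (\<Sum>i\<in>UNIV. skew_deriv i (\<sigma> (gvar i) - gvar i))) \<in> gmax_power (2 * k)"
proof -
  have "skew_deriv j (\<sigma> (gvar i)) = (if i = j then 1 else 0) + skew_deriv j (\<sigma> (gvar i) - gvar i)" for i j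
    by (simp add: skew_deriv_diff skew_deriv_gvar)
  then have "jac \<sigma> = gdet (\<lambda>i j. (if i = j then 1 else 0) + skew_deriv j (\<sigma> (gvar i) - gvar i))"
    by (simp add: jac_eq_gdet)
  then show ?thesis
    using gdet_one_plus[of "\<lambda>i j. skew_deriv j (\<sigma> (gvar i) - gvar i)" k]
      gmax_power_skew_deriv[OF assms] by simp
qed

section \<open>Even units and their congruences\<close>

lemma one_plus_image_iff: "u \<in> (\<lambda>f. 1 + f) ` S \<longleftrightarrow> u - 1 \<in> (S :: 'a::ring_1 set)"
  by (auto simp: image_iff intro: bexI[of _ "u - 1"])

lemma even_units_iff: "u \<in> even_units \<longleftrightarrow> u \<in> geven \<and> u - 1 \<in> gmax_power 2"
proof -
  have "d \<in> {2 * m | m. 1 \<le> m} \<longleftrightarrow> even d \<and> 2 \<le> d" for d :: nat by (auto elim!: evenE)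
  then have g: "f \<in> gpart {2 * m | m. 1 \<le> m} \<longleftrightarrow> f \<in> geven \<and> f \<in> gmax_power 2" for f :: "('a, 'b) grassmann"
    unfolding gpart_def gmax_power_iff by blast
  have "u \<in> geven \<longleftrightarrow> u - 1 \<in> geven"
    using gpart_add[OF _ geven_1, of "u - 1"] gpart_diff[OF _ geven_1, of u] by auto
  moreover have "u \<in> even_units \<longleftrightarrow> u - 1 \<in> gpart {2 * m | m. 1 \<le> m}"
    by (simp only: even_units_def one_plus_image_iff)
  ultimately show ?thesis unfolding g by blast
qed

lemma even_units_ge_iff: "u \<in> even_units_ge k \<longleftrightarrow> u \<in> even_units \<and> u - 1 \<in> gmax_power k"
  by (simp only: even_units_ge_def Int_iff one_plus_image_iff)

text \<open>Multiplication by \<open>u\<close> is the identity to leading order and preserves the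
  even part, so \<open>filtered_surj\<close> reaches \<open>1\<close> from an even element.\<close>

lemma even_units_inverse:
  fixes u :: "('k::comm_ring_1, 'n::{finite,linorder}) grassmann"
  assumes "u \<in> even_units"
  obtains v where "v \<in> even_units" "u * v = 1"
proof -
  have u: "u \<in> geven" "u - 1 \<in> gmax_power 2" using assms by (auto simp: even_units_iff)
  have "u * f - f \<in> gmax_power (Suc k)" if "f \<in> gmax_power k" for f k
    using gmax_power_mult[OF u(2) that] gmax_power_mono[of "(u - 1) * f" "2 + k" "Suc k"]
    by (simp add: left_diff_distrib)
  from filtered_surj[where F = "(*) u" and D = "{d. even d}" and g = 1 and k = 0, OF distrib_left this]
  obtain v where v: "v \<in> geven" "u * v = 1" using geven_mult[OF u(1)] by auto
  have "v - 1 = - ((u - 1) * v)" using v(2) by (simp add: left_diff_distrib)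
  then have "v - 1 \<in> gmax_power 2" using u(2) by (simp add: gmax_power_uminus gmax_power_multL)
  then show ?thesis using that v by (simp add: even_units_iff)
qed

text \<open>Reduces equality of cosets to the order of a difference. With \<open>v'\<close> inverse
  to \<open>v\<close>, an element \<open>u * w\<close> of one coset is \<open>v\<close> times
  \<open>v' * (u * w)\<close>, and the latter lies again in the subgroup.\<close>

lemma even_units_congI:
  assumes "u \<in> even_units" "v \<in> even_units" "u - v \<in> gmax_power k"
  shows "even_units_cong u v k"
proof -
  have sub: "(\<lambda>w. u * w) ` even_units_ge k \<subseteq> (\<lambda>w. v * w) ` even_units_ge k"
    if uv: "u \<in> even_units" "v \<in> even_units" "u - v \<in> gmax_power k" for u v :: "('a, 'b) grassmann"
  proof
    fix x assume "x \<in> (\<lambda>w. u * w) ` even_units_ge k"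
    then obtain w where w: "w \<in> even_units_ge k" "x = u * w" by blast
    obtain v' where v': "v' \<in> even_units" "v * v' = 1" using uv(2) by (rule even_units_inverse)
    have "v' * v = 1" using v' geven_commute[of v' v] by (simp add: even_units_iff)
    \<comment> \<open>Stated for every \<open>l\<close>, since \<open>even_units_ge k\<close> asks
      for order \<open>2\<close> as well as order \<open>k\<close>.\<close>
    have *: "v' * (u * w) - 1 \<in> gmax_power l" if "u - v \<in> gmax_power l" "w - 1 \<in> gmax_power l" for l
    proof -
      have "v' * (u * w) - 1 = v' * ((u - v) * w + v * (w - 1))"
        using \<open>v' * v = 1\<close> by (simp add: algebra_simps)
      also have "\<dots> \<in> gmax_power l"
        by (intro gmax_power_multR[of "_ + _"] gmax_power_add gmax_power_multL[of "u - v"] gmax_power_multR[of "w - 1"] that)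
      finally show ?thesis .
    qed
    have "u - v \<in> gmax_power 2"
      using uv(1,2) gmax_power_diff[of "u - 1" 2 "v - 1"] by (simp add: even_units_iff)
    then have "v' * (u * w) - 1 \<in> gmax_power 2" "v' * (u * w) - 1 \<in> gmax_power k"
      using w(1) uv(3) by (auto intro!: * simp: even_units_iff even_units_ge_iff)
    moreover have "v' * (u * w) \<in> geven"
      using w(1) uv(1) v'(1) by (intro geven_mult) (auto simp: even_units_iff even_units_ge_iff)
    ultimately have "v' * (u * w) \<in> even_units_ge k"
      unfolding even_units_iff even_units_ge_iff by blast
    moreover have "x = v * (v' * (u * w))" using v'(2) w(2) by (simp flip: mult.assoc)
    ultimately show "x \<in> (\<lambda>w. v * w) ` even_units_ge k" by blast
  qed
  show ?thesis
    using sub[OF assms] sub[OF assms(2,1) gmax_power_diff_commute[OF assms(3)]] assms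
    by (auto simp: even_units_cong_def)
qed

lemma jac_even_units:
  assumes "\<sigma> \<in> Gam" shows "jac \<sigma> \<in> even_units"
proof -
  have s: "\<sigma> (gvar i) - gvar i \<in> gmax_power (Suc 2)" for i
    using assms by (simp add: Gam_def)
  have "jac \<sigma> - (1 + (\<Sum>i\<in>UNIV. skew_deriv i (\<sigma> (gvar i) - gvar i))) \<in> gmax_power 2"
    using gmax_power_mono[OF jac_first_order[of \<sigma> 2, OF s], of 2] by simp
  moreover have "(\<Sum>i\<in>UNIV. skew_deriv i (\<sigma> (gvar i) - gvar i)) \<in> gmax_power 2"
    by (intro gmax_power_sum gmax_power_skew_deriv s)
  ultimately have "jac \<sigma> - 1 \<in> gmax_power 2"
    using gmax_power_add[of "jac \<sigma> - (1 + (\<Sum>i\<in>UNIV. skew_deriv i (\<sigma> (gvar i) - gvar i)))" 2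
        "\<Sum>i\<in>UNIV. skew_deriv i (\<sigma> (gvar i) - gvar i)"] by simp
  then show ?thesis using geven_jac[OF assms] by (simp add: even_units_iff)
qed

lemma Gam_ge_iff: "\<sigma> \<in> Gam_ge k \<longleftrightarrow> \<sigma> \<in> Gam \<and> jac \<sigma> - 1 \<in> gmax_power k"
  unfolding Gam_ge_def even_units_ge_iff mem_Collect_eq using jac_even_units[of \<sigma>] by blast

section \<open>Invariance of the Berezin integral\<close>

text \<open>Up to sign, the top coefficient of \<open>f\<close> is the coefficient of
  \<open>skew_deriv r f\<close> at the complement of \<open>r\<close>.\<close>

lemma coeff_top_skew_deriv:
  assumes "skew_deriv r f = 0" shows "coeff f UNIV = 0"
proof -
  define c where "c = card {i \<in> UNIV - {r}. i < r}"
  have "(-1) ^ c * coeff f UNIV = coeff (skew_deriv r f) (UNIV - {r})"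
    by (simp only: coeff_skew_deriv c_def Diff_iff insertI1 simp_thms if_False insert_Diff_single insert_UNIV)
  then show ?thesis using assms by (cases "even c") simp_all
qed

text \<open>
  With \<open>u = J\<^sup>-\<^sup>1\<close>, the difference of both sides is \<open>u (b \<partial>f - \<partial>b f)\<close>, which is killed by
  \<open>\<partial> = \<partial>/\<partial>x\<^sub>r\<close> and so does not involve the top monomial.
\<close>

lemma top_coeff_transvection:
  assumes "b \<in> godd" "b \<in> gmax_power 3"
  shows "coeff (transvection r b (f * jac (inv (transvection r b)))) UNIV = coeff f UNIV"
proof -
  let ?t = "transvection r b" and ?D = "skew_deriv r"
  have t: "?t \<in> Gam" using transvection_graut[OF assms] by (rule graut_subset_Gam)
  define u where "u = ?t (jac (inv ?t))"
  have u: "u \<in> geven" unfolding u_def by (intro Gam_geven[OF t] geven_jac Gam_inv t)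
  have J: "jac ?t = 1 + ?D b"
    unfolding jac_eq_gdet by (subst gdet_single_row[of r]) (auto simp: transvection_gvar skew_deriv_gvar skew_deriv_add)
  have Db: "?D b \<in> geven" using assms(1) by (rule geven_skew_deriv)
  have uJ: "u * (1 + ?D b) = 1" using jac_inv[OF t] by (simp add: u_def J)
  then have Ju: "(1 + ?D b) * u = 1" by (simp add: geven_commute[OF u])
  \<comment> \<open>The Jacobian \<open>1 + ?D b\<close> has derivative \<open>0\<close> because
    \<open>?D\<close> squares to zero; hence so has its inverse \<open>u\<close>.\<close>
  have "?D u * (1 + ?D b) = ?D (u * (1 + ?D b))"
    by (simp add: skew_deriv_mult_geven[OF u] skew_deriv_add)
  then have "?D u * ((1 + ?D b) * u) = 0" unfolding uJ by (simp flip: mult.assoc)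
  then have Du: "?D u = 0" by (simp add: Ju)
  have "?t f * u - f = (?t f - f * (1 + ?D b)) * u"
    using Ju by (simp add: left_diff_distrib mult.assoc)
  also have "\<dots> = u * (b * ?D f - ?D b * f)"
    by (simp add: geven_commute[OF u] geven_commute[OF Db] transvection_def distrib_left)
  \<comment> \<open>Both \<open>b * ?D f\<close> and \<open>?D b * f\<close> have the derivative
    \<open>?D b * ?D f\<close>, and \<open>u\<close> acts as a constant.\<close>
  finally have "?D (?t f * u - f) = 0"
    by (simp add: skew_deriv_mult_geven[OF u] Du skew_deriv_diff skew_deriv_mult_geven[OF Db]
        skew_deriv_mult_godd[OF assms(1)])
  from coeff_top_skew_deriv[OF this] show ?thesis
    by (simp add: u_def alg_aut_mult[OF Gam_alg_aut[OF t]])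
qed

text \<open>\<open>\<sigma>(J(\<sigma>\<^sup>-\<^sup>1))\<close> is the inverse of \<open>J(\<sigma>)\<close>.\<close>

lemma top_coeff_Gam:
  assumes "\<sigma> \<in> Gam"
  shows "coeff (\<sigma> (f * jac (inv \<sigma>))) UNIV = coeff f UNIV"
  using Gam_subset_transvection_monoid[OF assms]
\<comment> \<open>\<open>f\<close> varies because the hypothesis is applied to
  \<open>?t (f * jac (inv ?t))\<close>.\<close>
proof (induction arbitrary: f)
  case id
  show ?case unfolding inv_id jac_id by simp
next
  case (comp \<sigma> b r)
  let ?t = "transvection r b"
  have s: "\<sigma> \<in> Gam" and t: "?t \<in> Gam"
    using comp.hyps by (auto intro: graut_subset_Gam transvection_monoid_graut transvection_graut)
  have "jac (inv (\<sigma> \<circ> ?t)) = inv ?t (jac (inv \<sigma>)) * jac (inv ?t)"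
    using jac_comp[OF Gam_inv[OF t] Gam_inv[OF s]] Gam_bij[OF s] Gam_bij[OF t] by (simp add: o_inv_distrib)
  also have "\<dots> = jac (inv ?t) * inv ?t (jac (inv \<sigma>))"
    by (rule geven_commute) (intro Gam_geven[OF Gam_inv[OF t]] geven_jac Gam_inv s t)
  finally have "?t (f * jac (inv (\<sigma> \<circ> ?t))) = ?t (f * jac (inv ?t)) * jac (inv \<sigma>)"
    by (simp add: alg_aut_mult[OF Gam_alg_aut[OF t]] alg_aut_inv_apply[OF Gam_alg_aut[OF t]] flip: mult.assoc)
  then have "coeff (\<sigma> (?t (f * jac (inv (\<sigma> \<circ> ?t))))) UNIV = coeff f UNIV"
    by (simp only: comp.IH top_coeff_transvection[OF comp.hyps(2,3)])
  then show ?case by (subst o_apply)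
qed

text \<open>The difference \<open>w\<close> of the Jacobian and \<open>1\<close> lives in the top
  degree and squares to zero, so the inverse Jacobian is \<open>1 - w\<close>. By
  \<open>top_coeff_Gam\<close> for the constant \<open>1\<close> its top coefficient
  vanishes.\<close>

lemma jac_eq_1:
  fixes \<sigma> :: "('k::comm_ring_1, 'n::{finite,linorder}) grassmann \<Rightarrow> ('k, 'n) grassmann"
  assumes "\<sigma> \<in> Gam" "jac \<sigma> - 1 \<in> gmax_power CARD('n)"
  shows "jac \<sigma> = 1"
proof -
  define w v where "w = jac \<sigma> - 1" and "v = \<sigma> (jac (inv \<sigma>))"
  have w: "w \<in> gmax_power CARD('n)" using assms by (simp add: w_def)
  have v: "v * (1 + w) = 1" using jac_inv[OF assms(1)] by (simp add: v_def w_def)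
  have "w * w = 0"
    by (rule gmax_power_trivial[OF gmax_power_mult[OF w w]]) simp
  then have "(1 + w) * (1 - w) = 1" by (simp add: algebra_simps)
  then have "v = v * (1 + w) * (1 - w)" by (simp only: mult.assoc mult_1_right)
  then have "v = 1 - w" by (simp only: v mult_1_left)
  moreover have "coeff v UNIV = 0" using top_coeff_Gam[OF assms(1), of 1] by (simp add: v_def coeff_1)
  ultimately have top: "coeff w UNIV = 0" by (simp add: coeff_1)
  have "w = 0"
  proof (rule grassmann_eqI)
    fix A :: "'n set"
    show "coeff w A = coeff 0 A"
    proof (cases "A = UNIV")
      case False
      then have "card A < CARD('n)" by (intro psubset_card_mono) auto
      then show ?thesis using w unfolding gmax_power_iff by fastforce
    qed (simp add: top)
  qed
  then show ?thesis by (simp add: w_def)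
qed

section \<open>The automorphisms \<open>\<phi>'\<^sub>a\<close> and the factorization\<close>

lemma tail_component_decomposition:
  fixes a :: "('k::comm_ring_1, 'n::{finite,linorder}) grassmann"
  assumes "a \<in> ghomog (2 * s)" "2 * s < CARD('n)"
  shows "is_tail_decomposition s a (tail_component s a)"
  unfolding tail_component_def by (rule theI'[OF ex1_tail_decomposition[OF assms]])

lemma tail_space_iff: "f \<in> tail_space s i \<longleftrightarrow> (\<forall>A. coeff f A \<noteq> 0 \<longrightarrow> card A = 2 * s \<and> i \<notin> A \<and> {i<..} \<subseteq> A)"
  unfolding tail_space_def by (rule span_gmonom_iff)

lemma tail_space_geven: "f \<in> tail_space s i \<Longrightarrow> f \<in> geven"
  and tail_space_gmax_power: "f \<in> tail_space s i \<Longrightarrow> f \<in> gmax_power (2 * s)"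
  unfolding tail_space_iff gmax_power_iff gpart_def by auto

lemma tail_space_skew_deriv:
  assumes "f \<in> tail_space s i" shows "skew_deriv i f = 0"
proof (rule grassmann_eqI)
  fix A
  have "coeff f (insert i A) = 0" using assms unfolding tail_space_iff by blast
  then show "coeff (skew_deriv i f) A = coeff 0 A" by (simp add: coeff_skew_deriv)
qed

text \<open>The displacements \<open>gvar i * c i\<close> are odd of order \<open>2 * s + 1\<close>,
  hence at least \<open>3\<close>, so \<open>Gam_values\<close> provides the automorphism.\<close>

lemma phi'_Gam_and_jac:
  fixes a :: "('k::comm_ring_1, 'n::{finite,linorder}) grassmann"
  assumes a: "a \<in> ghomog (2 * s)" "2 * s < CARD('n)" and s: "1 \<le> s"
  shows phi'_Gam: "phi' s a \<in> Gam"
    and jac_phi': "jac (phi' s a) - (1 + a) \<in> gmax_power (2 * s + 2)"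
proof -
  define I where "I = {i :: 'n. CARD('n) - 2 * s \<le> pos i}"
  define c where "c = tail_component s a"
  define y where "y i = (if CARD('n) - 2 * s \<le> pos i then gvar i * (1 + c i) else gvar i)" for i
  have dec: "is_tail_decomposition s a c" unfolding c_def by (rule tail_component_decomposition[OF a])
  then have c: "c i \<in> tail_space s i" if "i \<in> I" for i
    using that by (auto simp: is_tail_decomposition_def I_def)
  have sum_c: "a = (\<Sum>i\<in>I. c i)" using dec by (simp add: is_tail_decomposition_def I_def)
  have diff: "y i - gvar i = (if i \<in> I then gvar i * c i else 0)" for i
    by (simp add: y_def I_def distrib_left)
  have pow: "y i - gvar i \<in> gmax_power (Suc (2 * s))" for i
    using gmax_power_mult[OF gmax_power_gvar tail_space_gmax_power[OF c]] by (simp add: diff)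
  have "y i - gvar i \<in> godd \<inter> gmax_power 3" for i
  proof
    show "y i - gvar i \<in> godd"
      using godd_geven_mult[OF godd_gvar tail_space_geven[OF c]] by (simp add: diff)
    show "y i - gvar i \<in> gmax_power 3" using s by (intro gmax_power_mono[OF pow]) simp
  qed
  then obtain \<sigma> where \<sigma>: "\<sigma> \<in> Gam" "\<And>i. \<sigma> (gvar i) = y i" using Gam_values by blast
  have "phi' s a = \<sigma>"
    unfolding phi'_def
  proof (rule the_equality)
    show "\<sigma> \<in> Gam \<and> (\<forall>i. \<sigma> (gvar i) = (if CARD('n) - 2 * s \<le> pos i
        then gvar i * (1 + tail_component s a i) else gvar i))"
      using \<sigma> by (simp add: y_def c_def)
    fix \<tau> assume "\<tau> \<in> Gam \<and> (\<forall>i. \<tau> (gvar i) = (if CARD('n) - 2 * s \<le> pos i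
        then gvar i * (1 + tail_component s a i) else gvar i))"
    then show "\<tau> = \<sigma>"
      using \<sigma> by (intro alg_aut_eqI) (simp_all add: Gam_alg_aut y_def c_def)
  qed
  then show "phi' s a \<in> Gam" using \<sigma>(1) by simp
  have "(\<Sum>i\<in>UNIV. skew_deriv i (\<sigma> (gvar i) - gvar i)) = (\<Sum>i\<in>UNIV. if i \<in> I then c i else 0)"
    by (rule sum.cong[OF refl])
      (simp add: \<sigma>(2) diff skew_deriv_mult_godd skew_deriv_gvar tail_space_skew_deriv[OF c])
  also have "\<dots> = a" by (simp add: sum_c sum.If_cases)
  \<comment> \<open>The error has order \<open>4 * s\<close>, which is at least
    \<open>2 * s + 2\<close> since \<open>s\<close> is positive.\<close>
  finally have "jac \<sigma> - (1 + a) \<in> gmax_power (2 * (2 * s))"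
    using jac_first_order[of \<sigma> "2 * s"] pow by (simp add: \<sigma>(2))
  then show "jac (phi' s a) - (1 + a) \<in> gmax_power (2 * s + 2)"
    unfolding \<open>phi' s a = \<sigma>\<close> by (rule gmax_power_mono) (use s in simp)
qed

section \<open>Leading terms of Jacobians and splitting off one factor\<close>

lemma ghomog_gmax_power: "a \<in> ghomog d \<Longrightarrow> a \<in> gmax_power d"
  by (auto simp: gpart_def gmax_power_iff)

lemma ghomog_diff_eq:
  assumes "a \<in> ghomog d" "b \<in> ghomog d" "a - b \<in> gmax_power k" "d < k"
  shows "a = b"
proof (rule grassmann_eqI)
  fix A
  have "a - b \<in> ghomog d" using assms by (intro gpart_diff)
  then have "coeff (a - b) A = 0" using assms(3,4) unfolding gpart_def gmax_power_iff by fastforce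
  then show "coeff a A = coeff b A" by simp
qed

text \<open>In the cocycle formula \<rho> contributes a factor that is \<open>1\<close> up to order
  \<open>2 * s + 2\<close>, so the leading term is that of \<open>phi' s a\<close>.\<close>

lemma jac_phi'_comp:
  fixes a :: "('k::comm_ring_1, 'n::{finite,linorder}) grassmann"
  assumes a: "a \<in> ghomog (2 * s)" "2 * s < CARD('n)" "1 \<le> s" and \<rho>: "\<rho> \<in> Gam_ge (2 * s + 2)"
  shows "jac (phi' s a \<circ> \<rho>) - (1 + a) \<in> gmax_power (2 * s + 2)"
    and "phi' s a \<circ> \<rho> \<in> Gam_ge (2 * s)"
proof -
  note p = phi'_Gam[OF a]
  have r: "\<rho> \<in> Gam" "jac \<rho> - 1 \<in> gmax_power (2 * s + 2)" using \<rho> by (auto simp: Gam_ge_iff)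
  have "jac (phi' s a \<circ> \<rho>) - (1 + a)
      = phi' s a (jac \<rho> - 1) * jac (phi' s a) + (jac (phi' s a) - (1 + a))"
    by (simp add: jac_comp[OF p r(1)] alg_aut_diff[OF Gam_alg_aut[OF p]] alg_aut_1[OF Gam_alg_aut[OF p]]
        left_diff_distrib)
  also have "\<dots> \<in> gmax_power (2 * s + 2)"
    by (intro gmax_power_add jac_phi'[OF a] gmax_power_multL Gam_gmax_power[OF p] r(2))
  finally show 1: "jac (phi' s a \<circ> \<rho>) - (1 + a) \<in> gmax_power (2 * s + 2)" .
  from gmax_power_add[OF gmax_power_mono[OF 1, of "2 * s"] ghomog_gmax_power[OF a(1)]]
  show "phi' s a \<circ> \<rho> \<in> Gam_ge (2 * s)" by (simp add: Gam_ge_iff Gam_comp[OF p r(1)])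
qed

lemma Gam_ge_step:
  fixes \<sigma> :: "('k::comm_ring_1, 'n::{finite,linorder}) grassmann \<Rightarrow> ('k, 'n) grassmann"
  assumes \<sigma>: "\<sigma> \<in> Gam_ge (2 * s)" and s: "1 \<le> s" "2 * s < CARD('n)"
  obtains a \<rho> where "a \<in> ghomog (2 * s)" "\<rho> \<in> Gam_ge (2 * s + 2)" "\<sigma> = phi' s a \<circ> \<rho>"
proof -
  have g: "\<sigma> \<in> Gam" and j: "jac \<sigma> - 1 \<in> gmax_power (2 * s)" using \<sigma> by (auto simp: Gam_ge_iff)
  \<comment> \<open>The parameter of the factor to split off is the degree \<open>2 * s\<close>
    component of the Jacobian.\<close>
  define a where "a = Grassmann (\<lambda>A. if card A = 2 * s then coeff (jac \<sigma>) A else 0)"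
  have a: "a \<in> ghomog (2 * s)" by (simp add: a_def gpart_def)
  have ja: "jac \<sigma> - (1 + a) \<in> gmax_power (2 * s + 2)"
    unfolding gmax_power_iff
  proof (intro allI impI)
    fix A assume nz: "coeff (jac \<sigma> - (1 + a)) A \<noteq> 0"
    have "jac \<sigma> - (1 + a) \<in> gmax_power (2 * s)"
      unfolding diff_diff_eq[symmetric] by (rule gmax_power_diff[OF j ghomog_gmax_power[OF a]])
    then have "2 * s \<le> card A" using nz unfolding gmax_power_iff by blast
    \<comment> \<open>In degree \<open>2 * s\<close> the choice of \<open>a\<close> cancels the
      Jacobian, and \<open>1\<close> contributes nothing as \<open>s\<close> is positive. Parity
      then excludes degree \<open>2 * s + 1\<close>, so the order rises by two.\<close>
    moreover have "card A \<noteq> 2 * s" using nz s(1) by (auto simp: a_def coeff_1 split: if_splits)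
    moreover have "a \<in> geven" using a by (auto simp: gpart_def)
    then have "jac \<sigma> - (1 + a) \<in> geven" by (intro gpart_diff gpart_add geven_jac g geven_1)
    then have "even (card A)" using nz by (auto simp: gpart_def simp del: coeff_diff)
    ultimately show "2 * s + 2 \<le> card A" by presburger
  qed
  let ?p = "phi' s a"
  note p = phi'_Gam[OF a s(2) s(1)]
  define \<rho> where "\<rho> = inv ?p \<circ> \<sigma>"
  have r: "\<rho> \<in> Gam" unfolding \<rho>_def by (intro Gam_comp Gam_inv p g)
  have \<sigma>_eq: "\<sigma> = ?p \<circ> \<rho>"
    unfolding \<rho>_def by (simp add: Gam_inv_comp[OF p] flip: comp_assoc)
  obtain v where v: "jac ?p * v = 1" using even_units_inverse[OF jac_even_units[OF p]] by blast
  have "jac \<sigma> = ?p (jac \<rho>) * jac ?p" using jac_comp[OF p r] by (simp flip: \<sigma>_eq)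
  \<comment> \<open>The cocycle rule solved for \<rho>. Both Jacobians on the right are
    \<open>1 + a\<close> up to order \<open>2 * s + 2\<close>, and the inverse of \<open>?p\<close>
    preserves the order.\<close>
  then have "?p (jac \<rho> - 1) = (jac \<sigma> - jac ?p) * v"
    by (simp add: left_diff_distrib v mult.assoc alg_aut_diff[OF Gam_alg_aut[OF p]] alg_aut_1[OF Gam_alg_aut[OF p]])
  moreover have "jac \<sigma> - jac ?p \<in> gmax_power (2 * s + 2)"
    using gmax_power_diff[OF ja jac_phi'[OF a s(2) s(1)]] by simp
  ultimately have "?p (jac \<rho> - 1) \<in> gmax_power (2 * s + 2)" by (simp only: gmax_power_multL)
  from Gam_gmax_power[OF Gam_inv[OF p] this]
  have "\<rho> \<in> Gam_ge (2 * s + 2)"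
    unfolding Gam_ge_iff alg_aut_inv_apply[OF Gam_alg_aut[OF p]] using r by blast
  with a show ?thesis using \<sigma>_eq by (rule that)
qed

section \<open>Partial products and the factorization\<close>

text \<open>A variable lower end allows the leftmost factor to be peeled off in inductions.\<close>

definition phi'_range :: "nat \<Rightarrow> nat \<Rightarrow> (nat \<Rightarrow> ('k::comm_ring_1, 'n::{finite,linorder}) grassmann)
    \<Rightarrow> ('k, 'n) grassmann \<Rightarrow> ('k, 'n) grassmann"
  where "phi'_range t m a = foldr (\<circ>) (map (\<lambda>s. phi' s (a s)) [t..<Suc m]) id"

lemma phi'_product_eq_range: "phi'_product m a = phi'_range 1 m a"
  by (simp add: phi'_product_def phi'_range_def)

lemma phi'_range_empty: "phi'_range (Suc m) m a = id"
  by (simp add: phi'_range_def)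

lemma phi'_range_rec: "t \<le> m \<Longrightarrow> phi'_range t m a = phi' t (a t) \<circ> phi'_range (Suc t) m a"
  unfolding phi'_range_def by (subst upt_conv_Cons) auto

lemma phi'_range_cong:
  "(\<And>s. t \<le> s \<Longrightarrow> s \<le> m \<Longrightarrow> a s = b s) \<Longrightarrow> phi'_range t m a = phi'_range t m b"
  unfolding phi'_range_def by (intro arg_cong[where f = "\<lambda>xs. foldr (\<circ>) xs id"]) auto

text \<open>Descending induction from the empty product at \<open>t = Suc m\<close>; each further
  factor on the left costs two in the order.\<close>

lemma phi'_range_Gam_ge:
  fixes a :: "nat \<Rightarrow> ('k::comm_ring_1, 'n::{finite,linorder}) grassmann"
  assumes "2 * m < CARD('n)" "\<gamma> \<in> Gam_ge (2 * m + 2)"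
    and "t \<le> Suc m" "1 \<le> t" "\<And>s. t \<le> s \<Longrightarrow> s \<le> m \<Longrightarrow> a s \<in> ghomog (2 * s)"
  shows "phi'_range t m a \<circ> \<gamma> \<in> Gam_ge (2 * t)"
  using assms(3-5)
proof (induction rule: inc_induct)
  case base
  show ?case using assms(2) by (simp add: phi'_range_empty)
next
  case (step t)
  have e: "2 * Suc t = 2 * t + 2" by simp
  have "phi'_range (Suc t) m a \<circ> \<gamma> \<in> Gam_ge (2 * t + 2)"
    unfolding e[symmetric] by (rule step.IH) (use step.prems in auto)
  moreover have t: "t \<le> m" using step.hyps by simp
  ultimately show ?case
    unfolding phi'_range_rec[OF t] comp_assoc
    by (intro jac_phi'_comp(2)) (use step.prems assms(1) in auto)
qed

text \<open>Reads off the first parameter from the Jacobian, both for the congruences and for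
  uniqueness.\<close>

lemma phi'_range_jac:
  fixes a :: "nat \<Rightarrow> ('k::comm_ring_1, 'n::{finite,linorder}) grassmann"
  assumes "2 * m < CARD('n)" "\<gamma> \<in> Gam_ge (2 * m + 2)"
    and "t \<le> m" "1 \<le> t" "\<And>s. t \<le> s \<Longrightarrow> s \<le> m \<Longrightarrow> a s \<in> ghomog (2 * s)"
  shows "jac (phi'_range t m a \<circ> \<gamma>) - (1 + a t) \<in> gmax_power (2 * t + 2)"
proof -
  have "phi'_range (Suc t) m a \<circ> \<gamma> \<in> Gam_ge (2 * t + 2)"
    using phi'_range_Gam_ge[OF assms(1,2), of "Suc t" a] assms by simp
  from jac_phi'_comp(1)[OF _ _ _ this, of "a t"]
  show ?thesis using assms by (simp add: phi'_range_rec comp_assoc)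
qed

text \<open>Descending induction with \<sigma> varying: \<open>Gam_ge_step\<close> splits off the
  factor with index \<open>t\<close>, and the hypothesis treats the remainder, whose order is higher
  by two.\<close>

lemma phi'_range_exists:
  fixes \<sigma> :: "('k::comm_ring_1, 'n::{finite,linorder}) grassmann \<Rightarrow> ('k, 'n) grassmann"
  assumes "2 * m < CARD('n)" "t \<le> Suc m" "1 \<le> t" "\<sigma> \<in> Gam_ge (2 * t)"
  shows "\<exists>a \<gamma>. (\<forall>s. t \<le> s \<longrightarrow> s \<le> m \<longrightarrow> a s \<in> ghomog (2 * s)) \<and> \<gamma> \<in> Gam_ge (2 * m + 2)
    \<and> \<sigma> = phi'_range t m a \<circ> \<gamma>"
  using assms(2-4)
proof (induction arbitrary: \<sigma> rule: inc_induct)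
  case base
  \<comment> \<open>Nothing is left to split off: \<gamma> is \<sigma>, and on the empty range any
    family will do.\<close>
  then show ?case by (intro exI[of _ undefined] exI[of _ \<sigma>]) (simp add: phi'_range_empty)
next
  case (step t)
  obtain b \<rho> where b: "b \<in> ghomog (2 * t)" "\<rho> \<in> Gam_ge (2 * t + 2)" "\<sigma> = phi' t b \<circ> \<rho>"
    using Gam_ge_step[OF step.prems(2,1)] step.hyps assms(1) by auto
  have "2 * Suc t = 2 * t + 2" by simp
  then have "\<rho> \<in> Gam_ge (2 * Suc t)" using b(2) by (simp only:)
  then obtain a \<gamma> where a: "\<forall>s. Suc t \<le> s \<longrightarrow> s \<le> m \<longrightarrow> a s \<in> ghomog (2 * s)"
    "\<gamma> \<in> Gam_ge (2 * m + 2)" "\<rho> = phi'_range (Suc t) m a \<circ> \<gamma>"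
    using step.IH[of \<rho>] by (meson le_SucI step.prems(1))
  have "\<forall>s. t \<le> s \<longrightarrow> s \<le> m \<longrightarrow> (a(t := b)) s \<in> ghomog (2 * s)" using a(1) b(1) by auto
  moreover have "\<sigma> = phi'_range t m (a(t := b)) \<circ> \<gamma>"
    using step.hyps phi'_range_cong[of "Suc t" m "a(t := b)" a]
    by (simp add: b(3) a(3) phi'_range_rec comp_assoc)
  ultimately show ?case using a(2) by blast
qed

text \<open>Both factorizations have the same Jacobian, so their first parameters agree; the common
  first factor is injective and cancels.\<close>

lemma phi'_range_unique:
  fixes a b :: "nat \<Rightarrow> ('k::comm_ring_1, 'n::{finite,linorder}) grassmann"
  assumes "2 * m < CARD('n)" "\<gamma> \<in> Gam_ge (2 * m + 2)" "\<delta> \<in> Gam_ge (2 * m + 2)"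
    and "t \<le> Suc m" "1 \<le> t"
    and "\<And>s. t \<le> s \<Longrightarrow> s \<le> m \<Longrightarrow> a s \<in> ghomog (2 * s)"
    and "\<And>s. t \<le> s \<Longrightarrow> s \<le> m \<Longrightarrow> b s \<in> ghomog (2 * s)"
    and "phi'_range t m a \<circ> \<gamma> = phi'_range t m b \<circ> \<delta>"
  shows "(\<forall>s. t \<le> s \<longrightarrow> s \<le> m \<longrightarrow> a s = b s) \<and> \<gamma> = \<delta>"
  using assms(4-8)
proof (induction rule: inc_induct)
  case base
  then show ?case by (simp add: phi'_range_empty)
next
  case (step t)
  have ja: "jac (phi'_range t m a \<circ> \<gamma>) - (1 + a t) \<in> gmax_power (2 * t + 2)"
    by (rule phi'_range_jac) (use assms(1,2) step.hyps step.prems(1-3) in auto)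
  have jb: "jac (phi'_range t m a \<circ> \<gamma>) - (1 + b t) \<in> gmax_power (2 * t + 2)"
    unfolding step.prems(4) by (rule phi'_range_jac) (use assms(1,3) step.hyps step.prems(1-3) in auto)
  have "a t - b t \<in> gmax_power (2 * t + 2)" using gmax_power_diff[OF jb ja] by simp
  then have eq: "a t = b t"
    using step.hyps step.prems(1-3) by (intro ghomog_diff_eq[of "a t" "2 * t" "b t"]) auto
  have p: "phi' t (a t) \<in> Gam" by (rule phi'_Gam) (use assms(1) step.hyps step.prems(1-3) in auto)
  have "phi' t (a t) \<circ> (phi'_range (Suc t) m a \<circ> \<gamma>) = phi' t (a t) \<circ> (phi'_range (Suc t) m b \<circ> \<delta>)"
    using step.prems(4) unfolding phi'_range_rec[OF less_Suc_eq_le[THEN iffD1, OF step.hyps(2)]] comp_assoc eq .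
  then have "phi'_range (Suc t) m a \<circ> \<gamma> = phi'_range (Suc t) m b \<circ> \<delta>"
    by (rule injD[OF fun.inj_map[OF bij_is_inj[OF Gam_bij[OF p]]]])
  then have "(\<forall>s. Suc t \<le> s \<longrightarrow> s \<le> m \<longrightarrow> a s = b s) \<and> \<gamma> = \<delta>"
    using step.prems(1-3) by (intro step.IH) auto
  then show ?case using eq by (metis le_antisym not_less_eq_eq)
qed

text \<open>Reversing \<open>[1..<t]\<close> puts the inverse with index \<open>t - 1\<close>
  outermost, so each induction step cancels the leftmost remaining factor.\<close>

lemma phi'_range_cancel:
  fixes a :: "nat \<Rightarrow> ('k::comm_ring_1, 'n::{finite,linorder}) grassmann"
  assumes "2 * m < CARD('n)" "1 \<le> t" "t \<le> Suc m"
    "\<And>s. 1 \<le> s \<Longrightarrow> s \<le> m \<Longrightarrow> a s \<in> ghomog (2 * s)"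
  shows "foldr (\<circ>) (map (\<lambda>s. inv (phi' s (a s))) (rev [1..<t])) id \<circ> phi'_range 1 m a = phi'_range t m a"
  using assms(2,3)
proof (induction t rule: dec_induct)
  case base
  show ?case by simp
next
  case (step t)
  have p: "phi' t (a t) \<in> Gam" by (rule phi'_Gam) (use assms step in auto)
  have IH: "foldr (\<circ>) (map (\<lambda>s. inv (phi' s (a s))) (rev [1..<t])) id \<circ> phi'_range 1 m a = phi'_range t m a"
    by (rule step.IH) (use step.prems in simp)
  have "foldr (\<circ>) (map (\<lambda>s. inv (phi' s (a s))) (rev [1..<Suc t])) id
      = inv (phi' t (a t)) \<circ> foldr (\<circ>) (map (\<lambda>s. inv (phi' s (a s))) (rev [1..<t])) id"
    using step by simp
  then have "foldr (\<circ>) (map (\<lambda>s. inv (phi' s (a s))) (rev [1..<Suc t])) id \<circ> phi'_range 1 m a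
      = inv (phi' t (a t)) \<circ> phi'_range t m a"
    by (simp only: comp_assoc IH)
  also have "\<dots> = inv (phi' t (a t)) \<circ> phi' t (a t) \<circ> phi'_range (Suc t) m a"
    using step by (simp only: phi'_range_rec Suc_le_mono comp_assoc)
  also have "\<dots> = phi'_range (Suc t) m a" by (simp only: Gam_inv_comp[OF p] id_comp)
  finally show ?case .
qed

theorem theorem7p2:
  fixes \<sigma> :: "('k::comm_ring_1, 'n::{finite,linorder}) grassmann \<Rightarrow> ('k, 'n) grassmann"
  assumes "CARD('n) \<ge> 4" and "\<sigma> \<in> Gam"
  shows "(Gam_ge (2 * ((CARD('n) - 1) div 2) + 2) :: (('k, 'n) grassmann \<Rightarrow> ('k, 'n) grassmann) set) = Sig
    \<and> (\<exists>!(a\<gamma>). is_factorization \<sigma> (fst a\<gamma>) (snd a\<gamma>))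
    \<and> (\<forall>a \<gamma>. is_factorization \<sigma> a \<gamma> \<longrightarrow>
          even_units_cong (jac \<sigma>) (1 + a 1) 4
        \<and> (\<forall>t \<in> {2..(CARD('n) - 1) div 2}.
            even_units_cong
              (jac (foldr (\<circ>) (map (\<lambda>s. inv (phi' s (a s))) (rev [1..<t])) id \<circ> \<sigma>))
              (1 + a t) (2 * t + 2))
        \<and> \<gamma> = inv (phi'_product ((CARD('n) - 1) div 2) a) \<circ> \<sigma>)"
proof (intro conjI allI impI)
  let ?m = "(CARD('n) - 1) div 2"
  \<comment> \<open>The number of generators is \<open>2 * ?m + 1\<close> or
    \<open>2 * ?m + 2\<close>, so order \<open>2 * ?m + 2\<close> reaches the top degree and
    \<open>jac_eq_1\<close> applies.\<close>
  have m: "2 * ?m < CARD('n)" "1 \<le> ?m" "CARD('n) \<le> 2 * ?m + 2" using assms(1) by linarith+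
  show "(Gam_ge (2 * ?m + 2) :: (('k, 'n) grassmann \<Rightarrow> ('k, 'n) grassmann) set) = Sig"
    using jac_eq_1[OF _ gmax_power_mono[OF _ m(3)]] by (auto simp: Gam_ge_iff Sig_def)
  have fac: "(\<forall>s. 1 \<le> s \<longrightarrow> s \<le> ?m \<longrightarrow> a s \<in> ghomog (2 * s)) \<and> \<gamma> \<in> Gam_ge (2 * ?m + 2)
      \<and> \<sigma> = phi'_range 1 ?m a \<circ> \<gamma>" if "is_factorization \<sigma> a \<gamma>" for a \<gamma>
    using that by (auto simp: is_factorization_def phi'_product_eq_range)
  show "\<exists>!a\<gamma>. is_factorization \<sigma> (fst a\<gamma>) (snd a\<gamma>)"
  proof (rule ex_ex1I)
    have "\<sigma> \<in> Gam_ge (2 * 1)" using assms(2) jac_even_units[OF assms(2)] by (simp add: Gam_ge_iff even_units_iff)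
    from phi'_range_exists[OF m(1) _ _ this] obtain a \<gamma> where
      a: "\<forall>s. 1 \<le> s \<longrightarrow> s \<le> ?m \<longrightarrow> a s \<in> ghomog (2 * s)" "\<gamma> \<in> Gam_ge (2 * ?m + 2)"
        "\<sigma> = phi'_range 1 ?m a \<circ> \<gamma>" by auto
    \<comment> \<open>Restriction supplies the default \<open>undefined\<close> that the extensional
      function space demands.\<close>
    have "is_factorization \<sigma> (restrict a {1..?m}) \<gamma>"
      using a phi'_range_cong[of 1 ?m "restrict a {1..?m}" a]
      by (auto simp: is_factorization_def phi'_product_eq_range)
    then show "\<exists>a\<gamma>. is_factorization \<sigma> (fst a\<gamma>) (snd a\<gamma>)" by (intro exI[of _ "(_, _)"]) simp
  next
    fix p q assume pq: "is_factorization \<sigma> (fst p) (snd p)" "is_factorization \<sigma> (fst q) (snd q)"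
    have "(\<forall>s. 1 \<le> s \<longrightarrow> s \<le> ?m \<longrightarrow> fst p s = fst q s) \<and> snd p = snd q"
      by (rule phi'_range_unique[OF m(1)]) (use fac[OF pq(1)] fac[OF pq(2)] in auto)
    \<comment> \<open>Both families are \<open>undefined\<close> outside the index range, so
      agreement on it is equality.\<close>
    moreover have "fst p = fst q"
    proof (rule PiE_ext)
      show "fst p \<in> (\<Pi>\<^sub>E s \<in> {1..?m}. ghomog (2 * s))" "fst q \<in> (\<Pi>\<^sub>E s \<in> {1..?m}. ghomog (2 * s))"
        using pq by (simp_all only: is_factorization_def)
    qed (use calculation in auto)
    ultimately show "p = q" by (simp add: prod_eq_iff)
  qed
  fix a \<gamma> assume "is_factorization \<sigma> a \<gamma>"
  note f = fac[OF this]
  \<comment> \<open>One statement for all the congruences: \<open>t = 1\<close> concerns \<sigma>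
    itself, larger \<open>t\<close> what remains after removing the first \<open>t - 1\<close>
    factors.\<close>
  have cong: "even_units_cong (jac (phi'_range t ?m a \<circ> \<gamma>)) (1 + a t) (2 * t + 2)" if t: "1 \<le> t" "t \<le> ?m" for t
  proof (rule even_units_congI)
    have "phi'_range t ?m a \<circ> \<gamma> \<in> Gam_ge (2 * t)"
      by (rule phi'_range_Gam_ge) (use f m t in auto)
    then show "jac (phi'_range t ?m a \<circ> \<gamma>) \<in> even_units" by (simp add: Gam_ge_iff jac_even_units)
    have at: "a t \<in> ghomog (2 * t)" using f t by blast
    then have "a t \<in> geven" by (auto simp: gpart_def)
    then show "1 + a t \<in> even_units"
      using gmax_power_mono[OF ghomog_gmax_power[OF at], of 2] t by (simp add: even_units_iff gpart_add)
    show "jac (phi'_range t ?m a \<circ> \<gamma>) - (1 + a t) \<in> gmax_power (2 * t + 2)"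
      by (rule phi'_range_jac) (use f m t in auto)
  qed
  show "even_units_cong (jac \<sigma>) (1 + a 1) 4" using cong[of 1] f m(2) by simp
  show "\<gamma> = inv (phi'_product ?m a) \<circ> \<sigma>"
  proof -
    \<comment> \<open>Taking the identity as last factor shows that the product itself lies in
      \<open>Gam\<close>.\<close>
    have "id \<in> Gam_ge (2 * ?m + 2)" by (simp add: Gam_ge_iff Gam_id jac_id)
    from phi'_range_Gam_ge[OF m(1) this, of 1 a] have g: "phi'_range 1 ?m a \<in> Gam"
      using f by (simp add: Gam_ge_iff)
    have "inv (phi'_range 1 ?m a) \<circ> \<sigma> = inv (phi'_range 1 ?m a) \<circ> phi'_range 1 ?m a \<circ> \<gamma>"
      using f by (simp only: comp_assoc)
    then show ?thesis by (simp only: phi'_product_eq_range Gam_inv_comp(1)[OF g] id_comp)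
  qed
  show "\<forall>t \<in> {2..?m}. even_units_cong
      (jac (foldr (\<circ>) (map (\<lambda>s. inv (phi' s (a s))) (rev [1..<t])) id \<circ> \<sigma>)) (1 + a t) (2 * t + 2)"
  proof
    fix t assume t: "t \<in> {2..?m}"
    have c: "foldr (\<circ>) (map (\<lambda>s. inv (phi' s (a s))) (rev [1..<t])) id \<circ> phi'_range 1 ?m a = phi'_range t ?m a"
      by (rule phi'_range_cancel) (use f m t in auto)
    have "\<sigma> = phi'_range 1 ?m a \<circ> \<gamma>" using f by blast
    then have "foldr (\<circ>) (map (\<lambda>s. inv (phi' s (a s))) (rev [1..<t])) id \<circ> \<sigma> = phi'_range t ?m a \<circ> \<gamma>"
      unfolding c[symmetric] comp_assoc by (rule arg_cong)
    then show "even_units_cong (jac (foldr (\<circ>) (map (\<lambda>s. inv (phi' s (a s))) (rev [1..<t])) id \<circ> \<sigma>))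
        (1 + a t) (2 * t + 2)"
      using cong[of t] t by simp
  qed
qed

end
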